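(* Let $n\ge 2$ and $s\in\mathbb R$. Let $\mathbb H^n_s=\{x\in\mathbb H^n : x_1\le s\}$, with boundary $\Sigma_s=\{x\in\mathbb H^n : x_1=s\}$, induced metric $\gamma_s=b|_{\Sigma_s}$ and outward unit normal $\eta_s=\nabla_bV_{(1)}/|\nabla_bV_{(1)}|$ along $\Sigma_s$. Then along $\Sigma_s$ one has $|\nabla_b V_{(1)}|=\sqrt{1+s^2}$, and the second fundamental form $\Pi_s$ of $\Sigma_s$ is $$\Pi_s=\lambda_s\gamma_s,\qquad \lambda_s=\frac{V_{(1)}}{|\nabla_bV_{(1)}|}=\frac{s}{\sqrt{1+s^2}}.$$ Moreover, for each $i\ne 1$, $$\frac{\partial V_{(i)}}{\partial \eta_s}=\lambda_sV_{(i)}\quad\text{along }\Sigma_s .$$ In particular, $(\mathbb H^n_s,b,\Sigma_s)$ is a static manifold with boundary with cosmological constants $(\widetilde\Lambda,\widetilde\lambda)=\left(-\tfrac{n(n-1)}{2},(n-1)\lambda_s\right)$, and the corresponding space of static potentials (together with $0$) is the linear span $$\mathcal N_{b,s}=[V_{(0)},V_{(2)},\dots,V_{(n)}].$$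
   Context: Hyperboloid model: $\mathbb R^{1,n}$ is Minkowski space with $\langle x,x\rangle_{1,n}=-x_0^2+x_1^2+\dots+x_n^2$; $\mathbb H^n=\{x\in\mathbb R^{1,n}:\langle x,x\rangle_{1,n}=-1,\ x_0>0\}$, with induced Riemannian metric $b$; $V_{(i)}=x_i|_{\mathbb H^n}$, $i=0,1,\dots,n$. Static manifold with boundary: a triple $(M^n,g,\Sigma)$, $\Sigma=\partial M$, is a static manifold with boundary with cosmological constants $(\widetilde\Lambda,\widetilde\lambda)$ if, with $\Lambda=\frac{2}{n-1}\widetilde\Lambda$ and $\lambda=\frac1{n-1}\widetilde\lambda$, there is a function $V\not\equiv0$ on $M$ (a static potential) with $$\nabla_g^2V+\Lambda Vg-V\,\mathrm{Ric}_g=0,\qquad \Delta_gV+\Lambda V=0\quad\text{in }M,$$ $$\pi_g-\lambda\,g|_\Sigma=0,\qquad \frac{\partial V}{\partial\eta}-\lambda V=0\quad\text{along }\Sigma.$$ Here $\eta$ is the outward unit normal and $\pi_g$ (denoted $\Pi_s$ for $\Sigma_s$) is the second fundamental form associated to the shape operator $\nabla\eta$, i.e. $\pi_g(X,Y)=g(\nabla_X\eta,Y)$ (so the unit sphere bounding the Euclidean unit ball has shape operator equal to the identity). *)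

theory Defs
  imports "HOL-Analysis.Analysis"
begin

section \<open>Smooth maps\<close>

primrec Ck_on :: "nat \<Rightarrow> 'a::euclidean_space set \<Rightarrow> ('a \<Rightarrow> 'b::real_normed_vector) \<Rightarrow> bool" where
  "Ck_on 0 U f \<longleftrightarrow> continuous_on U f"
| "Ck_on (Suc k) U f \<longleftrightarrow>
     (\<forall>x\<in>U. f differentiable (at x)) \<and> (\<forall>v. Ck_on k U (\<lambda>x. frechet_derivative f (at x) v))"

text \<open>On a set that is not open (such as a relatively open piece of a half-space), smoothness means
  that the map has a smooth extension to an ambient neighbourhood of each point.\<close>

definition smooth_on :: "'a::euclidean_space set \<Rightarrow> ('a \<Rightarrow> 'b::real_normed_vector) \<Rightarrow> bool" where
  "smooth_on S f \<longleftrightarrow>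
     (\<forall>x\<in>S. \<exists>U F. open U \<and> x \<in> U \<and> (\<forall>k. Ck_on k U F) \<and> (\<forall>y\<in>U \<inter> S. F y = f y))"

section \<open>Riemannian manifolds with boundary, embedded in a vector space\<close>

text \<open>A local parametrization \<open>param\<close> of an \<open>n\<close>-dimensional manifold with boundary is defined on a
  relatively open subset of the closed half-space \<open>{x. covec \<bullet> x \<le> level}\<close> of \<open>real^'n\<close>.
  Parametrizations of open pieces of the interior have \<open>covec = 0\<close> and \<open>level = 0\<close>.\<close>

record ('a, 'n) chart =
  base :: "(real^'n::finite) set"
  covec :: "real^'n"
  level :: real
  param :: "real^'n \<Rightarrow> 'a"

definition chart_dom :: "('a, 'n::finite) chart \<Rightarrow> (real^'n) set" where
  "chart_dom C = {x \<in> base C. covec C \<bullet> x \<le> level C}"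

definition chart_bdry :: "('a, 'n::finite) chart \<Rightarrow> (real^'n) set" where
  "chart_bdry C = {x \<in> base C. covec C \<noteq> 0 \<and> covec C \<bullet> x = level C}"

text \<open>Derivatives are taken within the coordinate domain, so that they also make sense at the
  points of the boundary.\<close>

definition pd ::
  "('a, 'n::finite) chart \<Rightarrow> 'n \<Rightarrow> (real^'n \<Rightarrow> 'b::real_normed_vector) \<Rightarrow> real^'n \<Rightarrow> 'b" where
  "pd C i f x = frechet_derivative f (at x within chart_dom C) (axis i 1)"

text \<open>A metric tensor on a manifold \<open>M\<close> contained in the vector space \<open>'a\<close> is a function \<open>g\<close>, where
  \<open>g p\<close> is a bilinear form on \<open>'a\<close> of which only the restriction to the tangent space of \<open>M\<close> at \<open>p\<close>
  matters.\<close>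

definition gmat ::
  "('a::euclidean_space, 'n::finite) chart \<Rightarrow> ('a \<Rightarrow> 'a \<Rightarrow> 'a \<Rightarrow> real) \<Rightarrow> real^'n \<Rightarrow> real^'n^'n" where
  "gmat C g x = (\<chi> i j. g (param C x) (pd C i (param C) x) (pd C j (param C) x))"

text \<open>The parametrizations are homeomorphisms onto relatively open subsets of \<open>M\<close>, and they are
  immersions because \<open>gmat\<close> is positive definite; hence their transition maps are
  automatically smooth.\<close>

definition riemannian_manifold_with_boundary ::
  "'a::euclidean_space set \<Rightarrow> ('a, 'n::finite) chart set \<Rightarrow> ('a \<Rightarrow> 'a \<Rightarrow> 'a \<Rightarrow> real) \<Rightarrow> bool" where
  "riemannian_manifold_with_boundary M A g \<longleftrightarrow>
     M = (\<Union>C\<in>A. param C ` chart_dom C) \<and>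
     (\<forall>p\<in>M. bilinear (g p) \<and> (\<forall>u v. g p u v = g p v u)) \<and>
     (\<forall>C\<in>A.
        open (base C) \<and>
        openin (top_of_set M) (param C ` chart_dom C) \<and>
        (\<exists>\<psi>. homeomorphism (chart_dom C) (param C ` chart_dom C) (param C) \<psi>) \<and>
        smooth_on (chart_dom C) (param C) \<and>
        smooth_on (chart_dom C) (gmat C g) \<and>
        (\<forall>x\<in>chart_dom C. \<forall>v. v \<noteq> 0 \<longrightarrow> 0 < v \<bullet> (gmat C g x *v v)))"

definition manifold_boundary :: "('a, 'n::finite) chart set \<Rightarrow> 'a set" where
  "manifold_boundary A = (\<Union>C\<in>A. param C ` chart_bdry C)"

section \<open>Tensor calculus in a chart\<close>

text \<open>Tangent vectors at \<open>param C x\<close> are given by their components in \<open>real^'n\<close> with respect to the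
  coordinate frame.\<close>

definition gprod :: "('a::euclidean_space, 'n::finite) chart \<Rightarrow> ('a \<Rightarrow> 'a \<Rightarrow> 'a \<Rightarrow> real) \<Rightarrow>
    real^'n \<Rightarrow> real^'n \<Rightarrow> real^'n \<Rightarrow> real" where
  "gprod C g x v w = v \<bullet> (gmat C g x *v w)"

definition gnorm :: "('a::euclidean_space, 'n::finite) chart \<Rightarrow> ('a \<Rightarrow> 'a \<Rightarrow> 'a \<Rightarrow> real) \<Rightarrow>
    real^'n \<Rightarrow> real^'n \<Rightarrow> real" where
  "gnorm C g x v = sqrt (gprod C g x v v)"

definition christoffel :: "('a::euclidean_space, 'n::finite) chart \<Rightarrow> ('a \<Rightarrow> 'a \<Rightarrow> 'a \<Rightarrow> real) \<Rightarrow>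
    'n \<Rightarrow> 'n \<Rightarrow> 'n \<Rightarrow> real^'n \<Rightarrow> real" where
  "christoffel C g k i j x =
     (1/2) * (\<Sum>l\<in>UNIV. matrix_inv (gmat C g x) $ k $ l *
       (pd C i (\<lambda>y. gmat C g y $ j $ l) x + pd C j (\<lambda>y. gmat C g y $ i $ l) x
        - pd C l (\<lambda>y. gmat C g y $ i $ j) x))"

definition grad :: "('a::euclidean_space, 'n::finite) chart \<Rightarrow> ('a \<Rightarrow> 'a \<Rightarrow> 'a \<Rightarrow> real) \<Rightarrow>
    ('a \<Rightarrow> real) \<Rightarrow> real^'n \<Rightarrow> real^'n" where
  "grad C g f x = matrix_inv (gmat C g x) *v (\<chi> i. pd C i (f \<circ> param C) x)"

definition hess :: "('a::euclidean_space, 'n::finite) chart \<Rightarrow> ('a \<Rightarrow> 'a \<Rightarrow> 'a \<Rightarrow> real) \<Rightarrow>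
    ('a \<Rightarrow> real) \<Rightarrow> 'n \<Rightarrow> 'n \<Rightarrow> real^'n \<Rightarrow> real" where
  "hess C g f i j x =
     pd C i (pd C j (f \<circ> param C)) x
     - (\<Sum>k\<in>UNIV. christoffel C g k i j x * pd C k (f \<circ> param C) x)"

definition laplacian :: "('a::euclidean_space, 'n::finite) chart \<Rightarrow> ('a \<Rightarrow> 'a \<Rightarrow> 'a \<Rightarrow> real) \<Rightarrow>
    ('a \<Rightarrow> real) \<Rightarrow> real^'n \<Rightarrow> real" where
  "laplacian C g f x =
     (\<Sum>i\<in>UNIV. \<Sum>j\<in>UNIV. matrix_inv (gmat C g x) $ i $ j * hess C g f i j x)"

text \<open>Sign convention: round spheres have positive Ricci curvature.\<close>

definition ricci :: "('a::euclidean_space, 'n::finite) chart \<Rightarrow> ('a \<Rightarrow> 'a \<Rightarrow> 'a \<Rightarrow> real) \<Rightarrow>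
    'n \<Rightarrow> 'n \<Rightarrow> real^'n \<Rightarrow> real" where
  "ricci C g i j x =
     (\<Sum>k\<in>UNIV. pd C k (christoffel C g k i j) x - pd C j (christoffel C g k i k) x
       + (\<Sum>l\<in>UNIV. christoffel C g k k l x * christoffel C g l i j x
                   - christoffel C g k j l x * christoffel C g l i k x))"

text \<open>At a boundary point, the vectors tangent to the boundary are those annihilated by
  \<open>covec C\<close>, and the outward pointing ones are those on which \<open>covec C\<close> is positive.\<close>

definition outward_normal :: "('a::euclidean_space, 'n::finite) chart \<Rightarrow>
    ('a \<Rightarrow> 'a \<Rightarrow> 'a \<Rightarrow> real) \<Rightarrow> real^'n \<Rightarrow> real^'n" where
  "outward_normal C g x =
     (THE \<eta>. gnorm C g x \<eta> = 1 \<and> (\<forall>v. covec C \<bullet> v = 0 \<longrightarrow> gprod C g x \<eta> v = 0) \<and> 0 < covec C \<bullet> \<eta>)"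

definition normal_deriv :: "('a::euclidean_space, 'n::finite) chart \<Rightarrow>
    ('a \<Rightarrow> 'a \<Rightarrow> 'a \<Rightarrow> real) \<Rightarrow> ('a \<Rightarrow> real) \<Rightarrow> real^'n \<Rightarrow> real" where
  "normal_deriv C g f x =
     frechet_derivative (f \<circ> param C) (at x within chart_dom C) (outward_normal C g x)"

text \<open>The Levi-Civita derivative \<open>\<nabla>\<^sub>X W\<close> at \<open>x\<close>. Only the values of \<open>W\<close> on the line through \<open>x\<close> with
  direction \<open>X\<close> enter; so \<open>W\<close> may be given along the boundary only, if \<open>X\<close> is tangent to it.\<close>

definition cov_deriv :: "('a::euclidean_space, 'n::finite) chart \<Rightarrow> ('a \<Rightarrow> 'a \<Rightarrow> 'a \<Rightarrow> real) \<Rightarrow>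
    real^'n \<Rightarrow> real^'n \<Rightarrow> (real^'n \<Rightarrow> real^'n) \<Rightarrow> real^'n" where
  "cov_deriv C g x X W =
     vector_derivative (\<lambda>t. W (x + t *\<^sub>R X)) (at 0)
     + (\<chi> k. \<Sum>i\<in>UNIV. \<Sum>j\<in>UNIV. christoffel C g k i j x * X $ i * W x $ j)"

definition second_ff :: "('a::euclidean_space, 'n::finite) chart \<Rightarrow> ('a \<Rightarrow> 'a \<Rightarrow> 'a \<Rightarrow> real) \<Rightarrow>
    real^'n \<Rightarrow> real^'n \<Rightarrow> real^'n \<Rightarrow> real" where
  "second_ff C g x X Y = gprod C g x (cov_deriv C g x X (outward_normal C g)) Y"

section \<open>Static manifolds with boundary\<close>

text \<open>\<open>cL\<close> and \<open>cl\<close> are the cosmological constants; \<open>L\<close> and \<open>l\<close> are their normalizations, which enter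
  the equations.\<close>

definition static_potential :: "'a::euclidean_space set \<Rightarrow> ('a, 'n::finite) chart set \<Rightarrow>
    ('a \<Rightarrow> 'a \<Rightarrow> 'a \<Rightarrow> real) \<Rightarrow> real \<Rightarrow> real \<Rightarrow> ('a \<Rightarrow> real) \<Rightarrow> bool" where
  "static_potential M A g cL cl V \<longleftrightarrow>
    (let L = 2 / (real CARD('n) - 1) * cL;
         l = 1 / (real CARD('n) - 1) * cl
     in (\<forall>C\<in>A. smooth_on (chart_dom C) (V \<circ> param C)) \<and>
        (\<exists>p\<in>M. V p \<noteq> 0) \<and>
        (\<forall>C\<in>A. \<forall>x\<in>chart_dom C.
           (\<forall>i j. hess C g V i j x + L * V (param C x) * gmat C g x $ i $ j
                  - V (param C x) * ricci C g i j x = 0) \<and>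
           laplacian C g V x + L * V (param C x) = 0) \<and>
        (\<forall>C\<in>A. \<forall>x\<in>chart_bdry C.
           (\<forall>X Y. covec C \<bullet> X = 0 \<longrightarrow> covec C \<bullet> Y = 0 \<longrightarrow>
                  second_ff C g x X Y - l * gprod C g x X Y = 0) \<and>
           normal_deriv C g V x - l * V (param C x) = 0))"

definition static_manifold_with_boundary :: "'a::euclidean_space set \<Rightarrow> ('a, 'n::finite) chart set \<Rightarrow>
    ('a \<Rightarrow> 'a \<Rightarrow> 'a \<Rightarrow> real) \<Rightarrow> 'a set \<Rightarrow> real \<Rightarrow> real \<Rightarrow> bool" where
  "static_manifold_with_boundary M A g S cL cl \<longleftrightarrow>
     riemannian_manifold_with_boundary M A g \<and> S = manifold_boundary A \<and>
     (\<exists>V. static_potential M A g cL cl V)"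

section \<open>The hyperboloid model\<close>

text \<open>Minkowski space is \<open>real \<times> (real^'n)\<close>, the first factor being the time coordinate \<open>x\<^sub>0\<close> and
  \<open>'n\<close> being the index set of the space coordinates. The coordinate functions are indexed by
  \<open>'n option\<close>, with \<open>None\<close> for \<open>x\<^sub>0\<close>. Below, \<open>e :: 'n\<close> is the distinguished space index \<open>1\<close>.\<close>

type_synonym 'n minkowski = "real \<times> (real^'n)"

definition mink :: "'n::finite minkowski \<Rightarrow> 'n minkowski \<Rightarrow> real" where
  "mink u v = - (fst u * fst v) + snd u \<bullet> snd v"

definition hyperboloid :: "'n::finite minkowski set" where
  "hyperboloid = {x. mink x x = -1 \<and> fst x > 0}"

definition hyp_metric ::
  "'n::finite minkowski \<Rightarrow> 'n minkowski \<Rightarrow> 'n minkowski \<Rightarrow> real" where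
  "hyp_metric p = mink"

definition hyp_coord :: "'n::finite option \<Rightarrow> 'n minkowski \<Rightarrow> real" where
  "hyp_coord i p = (case i of None \<Rightarrow> fst p | Some j \<Rightarrow> snd p $ j)"

definition hyp_half :: "'n::finite \<Rightarrow> real \<Rightarrow> 'n minkowski set" where
  "hyp_half e s = {x \<in> hyperboloid. hyp_coord (Some e) x \<le> s}"

definition hyp_slice :: "'n::finite \<Rightarrow> real \<Rightarrow> 'n minkowski set" where
  "hyp_slice e s = {x \<in> hyperboloid. hyp_coord (Some e) x = s}"

text \<open>The hyperboloid is the graph of \<open>x\<^sub>0 = sqrt (1 + \<bar>y\<bar>\<^sup>2)\<close>; the projection to the space
  coordinates is thus a global chart, in which \<open>hyp_half\<close> is a half-space.\<close>

definition hyp_chart :: "'n::finite \<Rightarrow> real \<Rightarrow> ('n minkowski, 'n) chart" where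
  "hyp_chart e s = \<lparr>base = UNIV, covec = axis e 1, level = s, param = (\<lambda>y. (sqrt (1 + y \<bullet> y), y))\<rparr>"

definition hyp_lambda :: "real \<Rightarrow> real" where
  "hyp_lambda s = s / sqrt (1 + s\<^sup>2)"

end

theory Submission
  imports Defs
begin

text \<open>
  In the global chart \<open>y \<mapsto> (height y, y)\<close>, \<open>height y = sqrt (1 + y \<bullet> y)\<close>, the half of the hyperboloid is the
  half-space \<open>y $ e \<le> s\<close>, and everything can be computed: the metric is
  \<open>g\<^sub>i\<^sub>j = \<delta>\<^sub>i\<^sub>j - y\<^sub>i y\<^sub>j / (1 + y \<bullet> y)\<close>, the Christoffel symbols are \<open>\<Gamma>\<^sup>k\<^sub>i\<^sub>j = - y\<^sub>k g\<^sub>i\<^sub>j\<close>, and \<open>Ric = - (n - 1) g\<close>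
  (\<open>gmat_hyp\<close>, \<open>christoffel_hyp\<close>, \<open>ricci_hyp\<close>). The static equations in the interior therefore reduce to
  \<open>Hess V = V g\<close> (\<open>static_equations_hyp_iff\<close>).

  The solutions of this overdetermined equation are the restrictions \<open>a * height y + \<beta> \<bullet> y\<close> of linear
  functions on Minkowski space. That these are solutions is a computation (\<open>hess_restricted_linear\<close>).
  Conversely, for a solution \<open>f\<close> the function \<open>h = f - (\<Sum>k. y\<^sub>k \<partial>\<^sub>k f)\<close> satisfies a first order equation that
  makes \<open>h * height\<close> constant; then the Euclidean Hessian of \<open>f\<close> is that of a multiple of \<open>height\<close>, so their
  gradients differ by a constant on the convex half-space (\<open>restricted_linear_if_hess\<close>).

  On the boundary the gradient of the coordinate \<open>e\<close> is \<open>axis e 1 + s *\<^sub>R y\<close>, of length \<open>sqrt (1 + s\<^sup>2)\<close>. Its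
  normalization is the outward normal, an affine function of \<open>y\<close> with linear part \<open>hyp_lambda s\<close>; this is
  the shape operator (\<open>outward_normal_hyp\<close>, \<open>second_ff_hyp\<close>). The same formula shows that a restricted
  linear function satisfies the Robin condition with constant \<open>hyp_lambda s\<close> iff its coefficient along
  \<open>e\<close> is zero (\<open>normal_deriv_hyp\<close>), which singles out the stated span.
\<close>

section \<open>Maps of class \<open>C\<^sup>k\<close>\<close>

lemma Ck_on_cong:
  fixes f :: "'a::euclidean_space \<Rightarrow> 'b::real_normed_vector"
  assumes "open U" "Ck_on k U f" "\<And>x. x \<in> U \<Longrightarrow> f x = g x"
  shows "Ck_on k U g"
  using assms(2,3)
proof (induction k arbitrary: f g)
  case 0
  then show ?case by (simp cong: continuous_on_cong)
next
  case (Suc k)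
  have D: "(g has_derivative frechet_derivative f (at x)) (at x)" if "x \<in> U" for x
  proof (rule has_derivative_transform_within_open[OF _ assms(1) that])
    show "(f has_derivative frechet_derivative f (at x)) (at x)"
      using Suc.prems(1) that by (simp flip: frechet_derivative_works)
  qed (rule Suc.prems(2))
  then have eq: "frechet_derivative g (at x) = frechet_derivative f (at x)" if "x \<in> U" for x
    using frechet_derivative_at that by metis
  have "Ck_on k U (\<lambda>x. frechet_derivative g (at x) v)" for v
    by (rule Suc.IH[of "\<lambda>x. frechet_derivative f (at x) v"]) (use Suc.prems(1) eq in simp_all)
  moreover have "g differentiable (at x)" if "x \<in> U" for x
    using D[OF that] by (rule differentiableI)
  ultimately show ?case
    by simp
qed

lemma Ck_on_SucI:
  fixes f :: "'a::euclidean_space \<Rightarrow> 'b::real_normed_vector"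
  assumes "open U" "\<And>x. x \<in> U \<Longrightarrow> (f has_derivative D x) (at x)"
    and "\<And>v. Ck_on k U (\<lambda>x. D x v)"
  shows "Ck_on (Suc k) U f"
proof -
  have eq: "D x v = frechet_derivative f (at x) v" if "x \<in> U" for x v
    using assms(2)[OF that] frechet_derivative_at by metis
  then have "Ck_on k U (\<lambda>x. frechet_derivative f (at x) v)" for v
    by (rule Ck_on_cong[OF assms(1) assms(3)[of v]])
  then show ?thesis
    using assms(2) by (auto simp: differentiable_def)
qed

lemma Ck_on_SucD:
  fixes f :: "'a::euclidean_space \<Rightarrow> 'b::real_normed_vector"
  assumes "Ck_on (Suc k) U f"
  shows "Ck_on k U f"
  using assms
proof (induction k arbitrary: f)
  case 0
  then have "continuous_on U f"
    by (intro differentiable_imp_continuous_on) (auto simp: differentiable_on_def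
        intro: differentiable_at_withinI)
  then show ?case by simp
next
  case (Suc k)
  have "Ck_on (Suc k) U (\<lambda>x. frechet_derivative f (at x) v)" for v
    using Suc.prems by (subst (asm) Ck_on.simps(2)) blast
  then have "Ck_on k U (\<lambda>x. frechet_derivative f (at x) v)" for v
    by (rule Suc.IH)
  then show ?case using Suc.prems by simp
qed

lemma Ck_on_const:
  fixes c :: "'b::real_normed_vector"
  assumes "open U" shows "Ck_on k U (\<lambda>x::'a::euclidean_space. c)"
proof (induction k arbitrary: c)
  case (Suc k)
  show ?case
    by (rule Ck_on_SucI[where D = "\<lambda>x v. 0"]) (simp_all add: assms Suc.IH)
qed simp

lemma Ck_on_add:
  fixes f g :: "'a::euclidean_space \<Rightarrow> 'b::real_normed_vector"
  assumes "open U" "Ck_on k U f" "Ck_on k U g"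
  shows "Ck_on k U (\<lambda>x. f x + g x)"
  using assms(2,3)
proof (induction k arbitrary: f g)
  case (Suc k)
  have "Ck_on k U (\<lambda>x. frechet_derivative f (at x) v + frechet_derivative g (at x) v)" for v
    using Suc.prems by (intro Suc.IH) simp_all
  moreover have "((\<lambda>x. f x + g x) has_derivative
      (\<lambda>v. frechet_derivative f (at x) v + frechet_derivative g (at x) v)) (at x)" if "x \<in> U" for x
    using Suc.prems that by (intro has_derivative_add) (simp_all flip: frechet_derivative_works)
  ultimately show ?case
    by (intro Ck_on_SucI[OF assms(1)])
qed (simp add: continuous_on_add)

lemma Ck_on_bounded_linear:
  fixes L :: "'a::euclidean_space \<Rightarrow> 'b::real_normed_vector"
  assumes "open U" "bounded_linear L"
  shows "Ck_on k U L"
proof (cases k)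
  case 0
  then show ?thesis
    using linear_continuous_on[OF assms(2)] by simp
next
  case (Suc j)
  show ?thesis
    unfolding Suc
    by (rule Ck_on_SucI[where D = "\<lambda>x. L"])
       (use assms in \<open>auto intro: bounded_linear_imp_has_derivative Ck_on_const\<close>)
qed

text \<open>The derivative of \<open>P (f x) (g x)\<close> is a sum of two products of \<open>C\<^sup>k\<close> maps, which closes the
  induction on \<open>k\<close>. Scalar multiples, products and inner products are all instances.\<close>

lemma Ck_on_bounded_bilinear:
  fixes f :: "'a::euclidean_space \<Rightarrow> 'b::real_normed_vector"
  assumes "open U" "bounded_bilinear P" "Ck_on k U f" "Ck_on k U g"
  shows "Ck_on k U (\<lambda>x. P (f x) (g x))"
  using assms(3,4)
proof (induction k arbitrary: f g)
  case 0
  then show ?case using bounded_bilinear.continuous_on[OF assms(2)] by simp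
next
  case (Suc k)
  have "Ck_on k U (\<lambda>x. P (f x) (frechet_derivative g (at x) v) + P (frechet_derivative f (at x) v) (g x))" for v
    using Suc.prems Suc.prems[THEN Ck_on_SucD] by (intro Ck_on_add Suc.IH assms(1)) auto
  moreover have "((\<lambda>x. P (f x) (g x)) has_derivative
      (\<lambda>v. P (f x) (frechet_derivative g (at x) v) + P (frechet_derivative f (at x) v) (g x))) (at x)"
    if "x \<in> U" for x
    using Suc.prems that
    by (intro bounded_bilinear.FDERIV[OF assms(2)]) (simp_all flip: frechet_derivative_works)
  ultimately show ?case
    by (intro Ck_on_SucI[OF assms(1)])
qed

lemmas Ck_on_scaleR = Ck_on_bounded_bilinear[OF _ bounded_bilinear_scaleR]
lemmas Ck_on_mult = Ck_on_bounded_bilinear[OF _ bounded_bilinear_mult]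
lemmas Ck_on_inner = Ck_on_bounded_bilinear[OF _ bounded_bilinear_inner]

lemma smooth_onI:
  assumes "\<And>k. Ck_on k UNIV F" "\<And>x. x \<in> S \<Longrightarrow> F x = f x"
  shows "smooth_on S f"
  unfolding smooth_on_def using assms by (intro ballI exI[of _ UNIV] exI[of _ F]) auto

section \<open>The Gram matrix of the hyperboloid over the space coordinates\<close>

definition height :: "real^'n \<Rightarrow> real" where
  "height y = sqrt (1 + y \<bullet> y)"

text \<open>The metric of the hyperboloid in the global chart \<open>y \<mapsto> (height y, y)\<close>: the Euclidean identity minus
  the square of the differential of \<open>height\<close>.\<close>

definition hyp_gram :: "real^'n \<Rightarrow> real^'n^'n" where
  "hyp_gram y = (\<chi> i j. (if i = j then 1 else 0) - y $ i * y $ j / (1 + y \<bullet> y))"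

lemma one_plus_inner_pos [simp]: "0 < 1 + y \<bullet> (y::'a::real_inner)" "1 + y \<bullet> y \<noteq> 0"
  using inner_ge_zero[of y] by linarith+

lemma height_pos [simp]: "0 < height y" "height y \<noteq> 0"
  by (simp_all add: height_def)

lemma height_sq: "height y * height y = 1 + y \<bullet> y"
  by (simp add: height_def)

lemma has_derivative_height:
  "(height has_derivative (\<lambda>h. y \<bullet> h / height y)) (at y within S)"
  unfolding height_def
  by (auto intro!: derivative_eq_intros ext simp: inner_commute divide_simps)

text \<open>The function \<open>u = 1 / height\<close> satisfies \<open>D u v = - (y \<bullet> v) u\<^sup>3\<close>: its derivative is a polynomial in \<open>y\<close> and
  \<open>u\<close>, so smoothness follows by induction on the order. The square root itself need not be
  differentiated repeatedly, since \<open>height = (1 + y \<bullet> y) u\<close>.\<close>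

lemma Ck_on_inverse_height: "Ck_on k UNIV (\<lambda>y::real^'n. inverse (height y))"
proof (induction k)
  case 0
  have "continuous_on UNIV (\<lambda>y::real^'n. inverse (sqrt (1 + y \<bullet> y)))"
    by (intro continuous_intros) simp
  then show ?case
    by (simp add: height_def)
next
  case (Suc k)
  let ?u = "\<lambda>y::real^'n. inverse (height y)"
  have deriv: "(?u has_derivative (\<lambda>v. - ((v \<bullet> y) * (?u y * (?u y * ?u y))))) (at y)" for y
    by (rule has_derivative_eq_rhs[OF Deriv.has_derivative_inverse[OF _ has_derivative_height]])
       (auto simp: inner_commute divide_simps)
  have "Ck_on k UNIV (\<lambda>y. - v \<bullet> y * (?u y * (?u y * ?u y)))" for v
    by (intro Ck_on_mult Ck_on_bounded_linear bounded_linear_inner_right Suc.IH) simp_all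
  then show ?case
    by (intro Ck_on_SucI[OF _ deriv]) simp_all
qed

lemma Ck_on_height: "Ck_on k UNIV (height :: real^'n \<Rightarrow> real)"
proof -
  have "Ck_on k UNIV (\<lambda>y::real^'n. (1 + y \<bullet> y) * inverse (height y))"
    by (intro Ck_on_mult Ck_on_add Ck_on_inner Ck_on_const Ck_on_bounded_linear
        bounded_linear_ident Ck_on_inverse_height) simp_all
  moreover have "(1 + y \<bullet> y) * inverse (height y) = height y" for y :: "real^'n"
    by (simp flip: height_sq)
  ultimately show ?thesis
    by simp
qed

lemma Ck_on_hyp_gram: "Ck_on k UNIV (hyp_gram :: real^'n \<Rightarrow> real^'n^'n)"
proof -
  let ?O = "\<lambda>(y::real^'n) (z::real^'n). (\<chi> i j. y $ i * z $ j) :: real^'n^'n"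
  have "bilinear ?O"
    by (auto simp: bilinear_def vec_eq_iff algebra_simps intro!: linearI)
  then have "bounded_bilinear ?O"
    by (simp add: bilinear_conv_bounded_bilinear)
  then have "Ck_on k UNIV (\<lambda>y. hyp_gram 0 + (inverse (height y) * inverse (height y)) *\<^sub>R ?O y (- y))"
    by (intro Ck_on_add Ck_on_const Ck_on_scaleR Ck_on_mult Ck_on_inverse_height Ck_on_bounded_bilinear[of UNIV ?O]
        Ck_on_bounded_linear bounded_linear_ident bounded_linear_minus) simp_all
  moreover have "hyp_gram 0 + (inverse (height y) * inverse (height y)) *\<^sub>R ?O y (- y) = hyp_gram y" for y
    by (simp add: hyp_gram_def vec_eq_iff field_simps height_sq)
  ultimately show ?thesis
    by simp
qed

section \<open>Derivatives in the half-space chart\<close>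

text \<open>At a boundary point the half-space still contains short segments in the direction \<open>- axis m 1\<close> for
  every \<open>m\<close>, which is enough to determine the derivative.\<close>

lemma frechet_derivative_within_halfspace:
  fixes f :: "real^'n \<Rightarrow> 'b::real_normed_vector"
  assumes "y $ e \<le> s" "(f has_derivative D) (at y within {y. y $ e \<le> s})"
  shows "frechet_derivative f (at y within {y. y $ e \<le> s}) = D"
proof (rule frechet_derivative_unique_within[symmetric])
  show "(f has_derivative D) (at y within {y. y $ e \<le> s})" by fact
  then show "(f has_derivative frechet_derivative f (at y within {y. y $ e \<le> s})) (at y within {y. y $ e \<le> s})"
    by (metis differentiable_def frechet_derivative_works)
  fix i :: "real^'n" and r :: real assume "i \<in> Basis" "r > 0"
  then obtain m where "i = axis m 1"
    by (auto simp: Basis_vec_def)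
  then show "\<exists>d. 0 < \<bar>d\<bar> \<and> \<bar>d\<bar> < r \<and> y + d *\<^sub>R i \<in> {y. y $ e \<le> s}"
    using assms(1) \<open>r > 0\<close> by (intro exI[of _ "- r / 2"]) (auto simp: axis_def)
qed

lemma chart_dom_hyp_chart [simp]: "chart_dom (hyp_chart e s) = {y. y $ e \<le> s}"
  by (auto simp: chart_dom_def hyp_chart_def inner_axis')

lemma chart_bdry_hyp_chart [simp]: "chart_bdry (hyp_chart e s) = {y. y $ e = s}"
  by (auto simp: chart_bdry_def hyp_chart_def inner_axis' axis_eq_0_iff)

lemma covec_hyp_chart [simp]: "covec (hyp_chart e s) \<bullet> v = v $ e"
  by (simp add: hyp_chart_def inner_axis')

lemma param_hyp_chart: "param (hyp_chart e s) y = (height y, y)"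
  by (simp add: hyp_chart_def height_def)

lemma pd_hyp_chart:
  assumes "y $ e \<le> s" "(f has_derivative D) (at y within {y. y $ e \<le> s})"
  shows "pd (hyp_chart e s) i f y = D (axis i 1)"
  using frechet_derivative_within_halfspace[OF assms] by (simp add: pd_def)

lemma pd_hyp_chart_transform:
  assumes "y $ e \<le> s" "\<And>z. z $ e \<le> s \<Longrightarrow> f z = g z"
    and "(g has_derivative D) (at y within {y. y $ e \<le> s})"
  shows "pd (hyp_chart e s) i f y = D (axis i 1)"
  using assms by (intro pd_hyp_chart has_derivative_transform[of _ _ f g]) auto

lemma pd_has_derivative:
  fixes f :: "real^'n \<Rightarrow> 'b::real_normed_vector"
  assumes "f differentiable (at y within chart_dom C)"
  shows "(f has_derivative (\<lambda>h. \<Sum>i\<in>UNIV. h $ i *\<^sub>R pd C i f y)) (at y within chart_dom C)"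
proof -
  let ?D = "frechet_derivative f (at y within chart_dom C)"
  have D: "(f has_derivative ?D) (at y within chart_dom C)"
    using assms by (simp add: frechet_derivative_works)
  then have "linear ?D"
    by (rule has_derivative_linear)
  then have "?D h = (\<Sum>i\<in>UNIV. h $ i *\<^sub>R pd C i f y)" for h
    by (subst basis_expansion[of h, symmetric], unfold scalar_mult_eq_scaleR)
       (simp add: linear_sum linear_scale pd_def)
  then have "?D = (\<lambda>h. \<Sum>i\<in>UNIV. h $ i *\<^sub>R pd C i f y)"
    by auto
  then show ?thesis
    using D by simp
qed

section \<open>Algebra of the Gram matrix\<close>

lemma hyp_gram_sym: "hyp_gram y $ i $ j = hyp_gram y $ j $ i"
  by (simp add: hyp_gram_def mult.commute)

text \<open>Both the Gram matrix and its inverse are rank one perturbations of the identity; this sum computes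
  one component of the product of such a matrix with a vector.\<close>

lemma sum_delta_plus_rank_one:
  fixes u v :: "real^'n"
  shows "(\<Sum>j\<in>UNIV. ((if i = j then 1 else 0) + c * u $ j) * v $ j) = v $ i + c * (u \<bullet> v)"
  by (simp add: distrib_right sum.distrib mult_if_delta inner_vec_def sum_distrib_left mult.assoc)

lemma hyp_gram_mult_vec: "hyp_gram y *v v = v - ((y \<bullet> v) / (1 + y \<bullet> y)) *\<^sub>R y"
proof -
  have "(hyp_gram y *v v) $ i = v $ i - (y \<bullet> v) / (1 + y \<bullet> y) * y $ i" for i
    using sum_delta_plus_rank_one[of i "- y $ i / (1 + y \<bullet> y)" y v]
    by (simp add: hyp_gram_def matrix_vector_mult_def mult_ac)
  then show ?thesis
    by (simp add: vec_eq_iff)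
qed

text \<open>The radial direction is an eigenvector. This identity is what makes the contractions in the
  Christoffel symbols, the Ricci tensor and the Hessian equation collapse.\<close>

lemma hyp_gram_mult_base: "hyp_gram y *v y = (1 / (1 + y \<bullet> y)) *\<^sub>R y"
proof -
  have "y - ((y \<bullet> y) / (1 + y \<bullet> y)) *\<^sub>R y = (1 - (y \<bullet> y) / (1 + y \<bullet> y)) *\<^sub>R y"
    by (simp add: scaleR_left_diff_distrib)
  also have "1 - (y \<bullet> y) / (1 + y \<bullet> y) = 1 / (1 + y \<bullet> y)"
    by (simp add: field_simps)
  finally show ?thesis
    by (simp add: hyp_gram_mult_vec)
qed

lemma hyp_gram_axis: "(hyp_gram y *v axis m 1) $ i = hyp_gram y $ i $ m"
  by (simp add: matrix_vector_mult_basis column_def)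

lemma sum_hyp_gram_base:
  "(\<Sum>k\<in>UNIV. hyp_gram y $ i $ k * y $ k) = y $ i / (1 + y \<bullet> y)"
  using arg_cong[OF hyp_gram_mult_base, of "\<lambda>v. v $ i" y] by (simp add: matrix_vector_mult_def)

lemma matrix_inv_eqI:
  fixes A B :: "real^'n^'n"
  assumes "A ** B = mat 1" "B ** A = mat 1"
  shows "matrix_inv A = B"
proof -
  have "A ** matrix_inv A = mat 1 \<and> matrix_inv A ** A = mat 1"
    unfolding matrix_inv_def by (rule someI[of _ B]) (use assms in simp)
  then show ?thesis
    using assms(1) by (metis matrix_mul_assoc matrix_mul_lid matrix_mul_rid)
qed

text \<open>Sherman--Morrison for \<open>mat 1 - y y\<^sup>T / (1 + y \<bullet> y)\<close>.\<close>

lemma matrix_inv_hyp_gram: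
  "matrix_inv (hyp_gram y) = (\<chi> i j. (if i = j then 1 else 0) + y $ i * y $ j)" (is "_ = ?B")
proof (rule matrix_inv_eqI)
  have B: "?B *v v = v + (y \<bullet> v) *\<^sub>R y" for v
    using sum_delta_plus_rank_one[of _ "y $ _" y v]
    by (simp add: vec_eq_iff matrix_vector_mult_def mult.commute)
  have "hyp_gram y *v (?B *v v) = v" for v
    unfolding B by (simp add: matrix_vector_right_distrib matrix_vector_mult_scaleR hyp_gram_mult_base hyp_gram_mult_vec)
  then show "hyp_gram y ** ?B = mat 1"
    by (subst matrix_eq) (simp flip: matrix_vector_mul_assoc)
  then show "?B ** hyp_gram y = mat 1"
    by (simp add: matrix_left_right_inverse)
qed

text \<open>Positivity is the strict form of the Cauchy--Schwarz inequality caused by the extra summand 1.\<close>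

lemma hyp_gram_pos:
  assumes "v \<noteq> 0"
  shows "0 < v \<bullet> (hyp_gram y *v v)"
proof -
  have "(y \<bullet> v)\<^sup>2 \<le> (y \<bullet> y) * (v \<bullet> v)"
    by (rule Cauchy_Schwarz_ineq)
  also have "\<dots> < (1 + y \<bullet> y) * (v \<bullet> v)"
    using assms by (simp add: distrib_right)
  finally show ?thesis
    by (simp add: hyp_gram_mult_vec inner_diff_right field_simps power2_eq_square inner_commute)
qed

text \<open>Writing the derivative through the Gram matrix itself, instead of expanding it, displays the
  symmetries by which the Christoffel symbols reduce to one term.\<close>

lemma has_derivative_hyp_gram:
  "((\<lambda>z. hyp_gram z $ i $ j) has_derivative
     (\<lambda>h. - ((hyp_gram y *v h) $ i * y $ j + (hyp_gram y *v h) $ j * y $ i) / (1 + y \<bullet> y))) (at y within S)"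
proof -
  have "((\<lambda>z. (if i = j then 1 else 0) - z $ i * z $ j / (1 + z \<bullet> z)) has_derivative
     (\<lambda>h. - ((h $ i * y $ j + y $ i * h $ j) * (1 + y \<bullet> y) - y $ i * y $ j * (2 * (y \<bullet> h))) / ((1 + y \<bullet> y) * (1 + y \<bullet> y))))
     (at y within S)"
    by (auto intro!: derivative_eq_intros bounded_linear_imp_has_derivative bounded_linear_vec_nth
          simp: inner_commute simp del: divide_eq_eq eq_divide_eq,
        simp_all only: minus_divide_left minus_diff_eq, simp_all add: algebra_simps)
  moreover have "- ((h $ i * y $ j + y $ i * h $ j) * (1 + y \<bullet> y) - y $ i * y $ j * (2 * (y \<bullet> h))) / ((1 + y \<bullet> y) * (1 + y \<bullet> y))
     = - ((hyp_gram y *v h) $ i * y $ j + (hyp_gram y *v h) $ j * y $ i) / (1 + y \<bullet> y)" for h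
    unfolding hyp_gram_mult_vec by (simp add: divide_simps) (simp add: algebra_simps)
  ultimately show ?thesis
    by (simp add: hyp_gram_def)
qed

section \<open>Christoffel symbols and Ricci curvature\<close>

lemma gmat_hyp:
  fixes y :: "real^'n"
  assumes "y $ e \<le> s"
  shows "gmat (hyp_chart e s) hyp_metric y = hyp_gram y"
proof -
  let ?C = "hyp_chart e s" and ?b = "hyp_metric :: 'n minkowski \<Rightarrow> _"
  have "pd ?C i (param ?C) y = (y $ i / height y, axis i 1)" for i
    unfolding param_hyp_chart[abs_def]
    by (subst pd_hyp_chart[OF assms has_derivative_Pair[OF has_derivative_height has_derivative_ident]])
       (simp add: inner_axis)
  then show ?thesis
    by (simp add: gmat_def hyp_gram_def vec_eq_iff hyp_metric_def mink_def inner_axis' height_sq)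
       (simp add: axis_def)
qed

lemma pd_gmat_hyp:
  assumes "y $ e \<le> s"
  shows "pd (hyp_chart e s) m (\<lambda>z. gmat (hyp_chart e s) hyp_metric z $ i $ j) y =
    - (hyp_gram y $ i $ m * y $ j + hyp_gram y $ j $ m * y $ i) / (1 + y \<bullet> y)"
  by (subst pd_hyp_chart_transform[OF assms _ has_derivative_hyp_gram])
     (simp_all add: gmat_hyp hyp_gram_axis)

text \<open>Geometrically: the second derivatives of the embedding \<open>F(y) = (height y, y)\<close> decompose as
  \<open>\<partial>\<^sub>i \<partial>\<^sub>j F = (\<Sum>k. \<Gamma>\<^sup>k\<^sub>i\<^sub>j \<partial>\<^sub>k F) + g\<^sub>i\<^sub>j F\<close>, because \<open>F\<close> is the unit normal of the hyperboloid, and their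
  space components vanish, so \<open>\<Gamma>\<^sup>k\<^sub>i\<^sub>j = - y\<^sub>k g\<^sub>i\<^sub>j\<close>.\<close>

lemma christoffel_hyp:
  fixes y :: "real^'n"
  assumes "y $ e \<le> s"
  shows "christoffel (hyp_chart e s) hyp_metric k i j y = - y $ k * hyp_gram y $ i $ j"
proof -
  let ?C = "hyp_chart e s" and ?b = "hyp_metric :: 'n minkowski \<Rightarrow> _"
  let ?I = "matrix_inv (hyp_gram y)"
  have I: "(\<Sum>l\<in>UNIV. ?I $ k $ l * y $ l) = (1 + y \<bullet> y) * y $ k"
    by (simp only: matrix_inv_hyp_gram vec_lambda_beta sum_delta_plus_rank_one) (simp add: algebra_simps)
  have "pd ?C i (\<lambda>z. gmat ?C ?b z $ j $ l) y + pd ?C j (\<lambda>z. gmat ?C ?b z $ i $ l) y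
      - pd ?C l (\<lambda>z. gmat ?C ?b z $ i $ j) y = (- 2 * hyp_gram y $ i $ j * y $ l) / (1 + y \<bullet> y)" for l
    unfolding pd_gmat_hyp[OF assms] add_divide_distrib[symmetric] diff_divide_distrib[symmetric]
    by (rule arg_cong2[where f = "(/)"]) (simp_all add: hyp_gram_sym)
  then have "christoffel ?C ?b k i j y =
      1/2 * (\<Sum>l\<in>UNIV. ?I $ k $ l * (- 2 * hyp_gram y $ i $ j * y $ l / (1 + y \<bullet> y)))"
    by (simp add: christoffel_def gmat_hyp[OF assms])
  also have "\<dots> = - (hyp_gram y $ i $ j / (1 + y \<bullet> y)) * (\<Sum>l\<in>UNIV. ?I $ k $ l * y $ l)"
    by (simp add: sum_distrib_left sum_negf mult_ac)
  also note I
  finally show ?thesis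
    by simp
qed

lemma pd_christoffel_hyp:
  fixes y :: "real^'n"
  assumes "y $ e \<le> s"
  shows "pd (hyp_chart e s) m (christoffel (hyp_chart e s) hyp_metric k i j) y =
    - (if k = m then 1 else 0) * hyp_gram y $ i $ j
    + y $ k * (hyp_gram y $ i $ m * y $ j + hyp_gram y $ j $ m * y $ i) / (1 + y \<bullet> y)"
proof -
  let ?C = "hyp_chart e s" and ?b = "hyp_metric :: 'n minkowski \<Rightarrow> _"
  have "((\<lambda>z. - z $ k * hyp_gram z $ i $ j) has_derivative
      (\<lambda>h. - y $ k * (- ((hyp_gram y *v h) $ i * y $ j + (hyp_gram y *v h) $ j * y $ i) / (1 + y \<bullet> y))
          + (- h $ k) * hyp_gram y $ i $ j)) (at y within {y. y $ e \<le> s})"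
    by (intro has_derivative_mult has_derivative_hyp_gram)
       (intro has_derivative_minus bounded_linear_imp_has_derivative bounded_linear_vec_nth)
  from pd_hyp_chart_transform[where f = "christoffel ?C ?b k i j" and i = m, OF assms christoffel_hyp this]
  have "pd ?C m (christoffel ?C ?b k i j) y
      = - y $ k * (- (hyp_gram y $ i $ m * y $ j + hyp_gram y $ j $ m * y $ i) / (1 + y \<bullet> y))
        + (- axis m 1 $ k) * hyp_gram y $ i $ j"
    by (simp only: hyp_gram_axis)
  moreover have "- a * (- x / q) = a * x / q" for a x q :: real
    by simp
  ultimately show ?thesis
    by (simp only:) (simp add: axis_def)
qed

text \<open>Each of the four terms of the coordinate formula contracts by \<open>sum_hyp_gram_base\<close> to a combination
  of \<open>g\<^sub>i\<^sub>j\<close> and \<open>y\<^sub>i y\<^sub>j\<close>. The latter cancel, leaving the Einstein equation of hyperbolic space.\<close>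

lemma ricci_hyp:
  fixes y :: "real^'n"
  assumes "y $ e \<le> s"
  shows "ricci (hyp_chart e s) hyp_metric i j y = - (real CARD('n) - 1) * hyp_gram y $ i $ j"
proof -
  let ?C = "hyp_chart e s" and ?b = "hyp_metric :: 'n minkowski \<Rightarrow> _"
  let ?g = "hyp_gram y" and ?q = "1 + y \<bullet> y"
  have yy: "(\<Sum>k\<in>UNIV. y $ k * y $ k) = y \<bullet> y"
    by (simp add: inner_vec_def)
  have gy: "(\<Sum>k\<in>UNIV. ?g $ m $ k * y $ k) = y $ m / ?q" for m
    by (rule sum_hyp_gram_base)
  have 1: "(\<Sum>k\<in>UNIV. pd ?C k (christoffel ?C ?b k i j) y)
      = - real CARD('n) * ?g $ i $ j + 2 * (y $ i * y $ j) / (?q * ?q)"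
  proof -
    have "(\<Sum>k\<in>UNIV. pd ?C k (christoffel ?C ?b k i j) y)
      = (\<Sum>k\<in>UNIV. - ?g $ i $ j + (y $ j * (?g $ i $ k * y $ k) + y $ i * (?g $ j $ k * y $ k)) / ?q)"
      by (intro sum.cong) (simp_all add: pd_christoffel_hyp[OF assms] algebra_simps)
    also have "\<dots> = - real CARD('n) * ?g $ i $ j
        + (y $ j * (\<Sum>k\<in>UNIV. ?g $ i $ k * y $ k) + y $ i * (\<Sum>k\<in>UNIV. ?g $ j $ k * y $ k)) / ?q"
      by (simp add: sum.distrib sum_subtractf flip: sum_divide_distrib sum_distrib_left)
    finally show ?thesis
      unfolding gy by (simp add: algebra_simps)
  qed
  have 2: "(\<Sum>k\<in>UNIV. pd ?C j (christoffel ?C ?b k i k) y)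
      = - ?g $ i $ j + (?g $ i $ j * (y \<bullet> y) + y $ i * y $ j / ?q) / ?q"
  proof -
    have "(\<Sum>k\<in>UNIV. pd ?C j (christoffel ?C ?b k i k) y)
      = (\<Sum>k\<in>UNIV. (if k = j then - ?g $ i $ j else 0)
           + (?g $ i $ j * (y $ k * y $ k) + y $ i * (?g $ j $ k * y $ k)) / ?q)"
      by (intro sum.cong) (auto simp: pd_christoffel_hyp[OF assms] hyp_gram_sym[of y _ j] algebra_simps)
    also have "\<dots> = - ?g $ i $ j
        + (?g $ i $ j * (\<Sum>k\<in>UNIV. y $ k * y $ k) + y $ i * (\<Sum>k\<in>UNIV. ?g $ j $ k * y $ k)) / ?q"
      by (simp add: sum.distrib flip: sum_divide_distrib sum_distrib_left)
    finally show ?thesis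
      unfolding gy yy by simp
  qed
  have 3: "(\<Sum>k\<in>UNIV. \<Sum>l\<in>UNIV. christoffel ?C ?b k k l y * christoffel ?C ?b l i j y)
      = ?g $ i $ j * (y \<bullet> y) / ?q"
  proof -
    have "(\<Sum>k\<in>UNIV. \<Sum>l\<in>UNIV. christoffel ?C ?b k k l y * christoffel ?C ?b l i j y)
      = (\<Sum>k\<in>UNIV. (?g $ i $ j * y $ k) * (\<Sum>l\<in>UNIV. ?g $ k $ l * y $ l))"
      by (simp add: christoffel_hyp[OF assms] sum_distrib_left mult_ac)
    also have "\<dots> = ?g $ i $ j * (\<Sum>k\<in>UNIV. y $ k * y $ k) / ?q"
      unfolding gy by (simp add: sum_distrib_left sum_divide_distrib mult_ac)
    finally show ?thesis unfolding yy .
  qed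
  have 4: "(\<Sum>k\<in>UNIV. \<Sum>l\<in>UNIV. christoffel ?C ?b k j l y * christoffel ?C ?b l i k y)
      = y $ i * y $ j / (?q * ?q)"
  proof -
    have "(\<Sum>k\<in>UNIV. \<Sum>l\<in>UNIV. christoffel ?C ?b k j l y * christoffel ?C ?b l i k y)
      = (\<Sum>k\<in>UNIV. (?g $ i $ k * y $ k) * (\<Sum>l\<in>UNIV. ?g $ j $ l * y $ l))"
      by (simp add: christoffel_hyp[OF assms] sum_distrib_left mult_ac)
    also have "\<dots> = (\<Sum>k\<in>UNIV. ?g $ i $ k * y $ k) * (\<Sum>l\<in>UNIV. ?g $ j $ l * y $ l)"
      by (simp add: sum_distrib_right)
    finally show ?thesis unfolding gy by simp
  qed
  have "ricci ?C ?b i j y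
      = (\<Sum>k\<in>UNIV. pd ?C k (christoffel ?C ?b k i j) y) - (\<Sum>k\<in>UNIV. pd ?C j (christoffel ?C ?b k i k) y)
      + ((\<Sum>k\<in>UNIV. \<Sum>l\<in>UNIV. christoffel ?C ?b k k l y * christoffel ?C ?b l i j y)
      - (\<Sum>k\<in>UNIV. \<Sum>l\<in>UNIV. christoffel ?C ?b k j l y * christoffel ?C ?b l i k y))"
    unfolding ricci_def by (simp add: sum.distrib sum_subtractf)
  also have "\<dots> = - (real CARD('n) - 1) * ?g $ i $ j"
    unfolding 1 2 3 4 by (simp add: divide_simps) (simp add: algebra_simps)
  finally show ?thesis .
qed

section \<open>Potentials with Hessian proportional to the metric\<close>

text \<open>Derivatives of a local smooth extension restrict to derivatives within \<open>S\<close>. If the latter are unique,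
  this transfers two orders of differentiability from the extension to \<open>f\<close>, as needed to differentiate
  the Hessian equation up to the boundary.\<close>

lemma smooth_on_imp_differentiable_within:
  fixes f :: "'a::euclidean_space \<Rightarrow> 'b::real_normed_vector"
  assumes "smooth_on S f" "y \<in> S"
    and unique: "\<And>(g :: 'a \<Rightarrow> 'b) D z. z \<in> S \<Longrightarrow> (g has_derivative D) (at z within S)
      \<Longrightarrow> frechet_derivative g (at z within S) = D"
  shows "f differentiable (at y within S)"
    and "(\<lambda>z. frechet_derivative f (at z within S) v) differentiable (at y within S)"
proof -
  obtain U F where U: "open U" "y \<in> U" "\<And>k. Ck_on k U F" "\<And>z. z \<in> U \<inter> S \<Longrightarrow> F z = f z"
  proof -
    have "\<exists>U F. open U \<and> y \<in> U \<and> (\<forall>k. Ck_on k U F) \<and> (\<forall>z\<in>U \<inter> S. F z = f z)"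
      using assms(1,2) unfolding smooth_on_def by (rule bspec)
    then show thesis
      using that by fast
  qed
  have near: "(g has_derivative D) (at z within S)"
    if "z \<in> U \<inter> S" "(G has_derivative D) (at z)" "\<And>w. w \<in> U \<inter> S \<Longrightarrow> G w = g w"
    for g G :: "'a \<Rightarrow> 'b" and D z
  proof -
    have z: "z \<in> U"
      using that(1) by simp
    obtain r where "r > 0" "ball z r \<subseteq> U"
      by (rule openE[OF U(1) z])
    then show ?thesis
      using that
      by (intro has_derivative_transform_within[OF has_derivative_at_withinI[OF that(2)], of r])
         (auto simp: dist_commute subset_iff)
  qed
  have D: "(f has_derivative frechet_derivative F (at z)) (at z within S)" if "z \<in> U \<inter> S" for z
  proof (rule near[OF that _ U(4)])
    show "(F has_derivative frechet_derivative F (at z)) (at z)"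
      using U(3)[of "Suc 0"] that by (simp flip: frechet_derivative_works)
  qed
  show "f differentiable (at y within S)"
    by (rule differentiableI[OF D]) (use U assms in simp)
  have "(\<lambda>z. frechet_derivative F (at z) v) differentiable (at y)"
    using U(3)[of "Suc (Suc 0)"] U(2) by simp
  then obtain D' where "((\<lambda>z. frechet_derivative F (at z) v) has_derivative D') (at y)"
    by (auto simp: differentiable_def)
  then have "((\<lambda>z. frechet_derivative f (at z within S) v) has_derivative D') (at y within S)"
    by (rule near[rotated]) (use U assms unique[OF _ D] in simp_all)
  then show "(\<lambda>z. frechet_derivative f (at z within S) v) differentiable (at y within S)"
    by (rule differentiableI)
qed

lemma hess_hyp:
  fixes y :: "real^'n"
  assumes "y $ e \<le> s"
  shows "hess (hyp_chart e s) hyp_metric V i j y =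
    pd (hyp_chart e s) i (pd (hyp_chart e s) j (V \<circ> param (hyp_chart e s))) y
    + hyp_gram y $ i $ j * (\<Sum>k\<in>UNIV. y $ k * pd (hyp_chart e s) k (V \<circ> param (hyp_chart e s)) y)"
  unfolding hess_def christoffel_hyp[OF assms]
  by (simp add: sum_distrib_left sum_negf mult_ac)

lemma laplacian_hyp:
  fixes y :: "real^'n"
  assumes "y $ e \<le> s" "\<And>i j. hess (hyp_chart e s) hyp_metric V i j y = c * hyp_gram y $ i $ j"
  shows "laplacian (hyp_chart e s) hyp_metric V y = real CARD('n) * c"
proof -
  have trace: "(\<Sum>j\<in>UNIV. matrix_inv (hyp_gram y) $ i $ j * hyp_gram y $ i $ j) = 1" for i
  proof -
    have "(\<Sum>j\<in>UNIV. matrix_inv (hyp_gram y) $ i $ j * hyp_gram y $ i $ j)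
        = hyp_gram y $ i $ i + y $ i * (y \<bullet> (hyp_gram y $ i))"
      using sum_delta_plus_rank_one[of i "y $ i" y "hyp_gram y $ i"]
      by (simp add: matrix_inv_hyp_gram)
    also have "y \<bullet> (hyp_gram y $ i) = y $ i / (1 + y \<bullet> y)"
      using sum_hyp_gram_base[of y i] by (simp add: inner_vec_def mult.commute)
    finally show ?thesis
      by (simp add: hyp_gram_def)
  qed
  have "laplacian (hyp_chart e s) hyp_metric V y
      = (\<Sum>i\<in>UNIV. c * (\<Sum>j\<in>UNIV. matrix_inv (hyp_gram y) $ i $ j * hyp_gram y $ i $ j))"
    unfolding laplacian_def assms(2) gmat_hyp[OF assms(1)]
    by (simp add: sum_distrib_left mult_ac)
  then show ?thesis
    by (simp add: trace)
qed

text \<open>Since \<open>Ric = - (n - 1) g\<close>, the tensor equation with \<open>\<Lambda> = - n\<close> reads \<open>Hess V = V g\<close>, and the scalar equation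
  is its trace.\<close>

lemma static_equations_hyp_iff:
  fixes y :: "real^'n"
  assumes "y $ e \<le> s"
  shows "(\<forall>i j. hess (hyp_chart e s) hyp_metric V i j y
              + - real CARD('n) * V (param (hyp_chart e s) y) * gmat (hyp_chart e s) hyp_metric y $ i $ j
              - V (param (hyp_chart e s) y) * ricci (hyp_chart e s) hyp_metric i j y = 0) \<and>
         laplacian (hyp_chart e s) hyp_metric V y + - real CARD('n) * V (param (hyp_chart e s) y) = 0
     \<longleftrightarrow> (\<forall>i j. hess (hyp_chart e s) hyp_metric V i j y
              = V (param (hyp_chart e s) y) * hyp_gram y $ i $ j)"
    (is "(\<forall>i j. ?E i j) \<and> ?L \<longleftrightarrow> (\<forall>i j. ?H i j)")
proof -
  have "?E i j \<longleftrightarrow> ?H i j" for i j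
    unfolding gmat_hyp[OF assms] ricci_hyp[OF assms] by (simp add: algebra_simps)
  moreover have "?L" if "\<forall>i j. ?H i j"
    using laplacian_hyp[OF assms, of V "V (param (hyp_chart e s) y)"] that by simp
  ultimately show ?thesis
    by blast
qed

lemma has_derivative_div_height:
  "((\<lambda>z. z $ i / height z) has_derivative (\<lambda>h. (hyp_gram y *v h) $ i / height y)) (at y within S)"
proof -
  have "((\<lambda>z. z $ i / height z) has_derivative
      (\<lambda>h. (h $ i * height y - y $ i * (y \<bullet> h / height y)) / (height y * height y))) (at y within S)"
    by (intro has_derivative_divide' has_derivative_height bounded_linear_imp_has_derivative
        bounded_linear_vec_nth) simp
  moreover have "(h $ i * height y - y $ i * (y \<bullet> h / height y)) / (height y * height y)
      = (hyp_gram y *v h) $ i / height y" for h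
    unfolding hyp_gram_mult_vec by (simp flip: height_sq add: field_simps)
  ultimately show ?thesis
    by simp
qed

lemma has_derivative_height_plus_linear:
  "((\<lambda>z. a * height z + \<beta> \<bullet> z) has_derivative (\<lambda>h. a * (y \<bullet> h / height y) + \<beta> \<bullet> h)) (at y within S)"
  by (intro has_derivative_add has_derivative_mult_right has_derivative_height
      bounded_linear_imp_has_derivative bounded_linear_inner_right)

text \<open>Restrictions of linear functions of Minkowski space solve the Hessian equation: \<open>height\<close> has
  Euclidean Hessian \<open>g / height\<close>, and the Christoffel term supplies the rest.\<close>

lemma hess_restricted_linear:
  fixes y :: "real^'n"
  assumes "y $ e \<le> s"
    and V: "\<And>z. z $ e \<le> s \<Longrightarrow> V (param (hyp_chart e s) z) = a * height z + \<beta> \<bullet> z"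
  shows "hess (hyp_chart e s) hyp_metric V i j y = V (param (hyp_chart e s) y) * hyp_gram y $ i $ j"
proof -
  let ?C = "hyp_chart e s"
  have 1: "pd ?C k (V \<circ> param ?C) z = a * (z $ k / height z) + \<beta> $ k" if "z $ e \<le> s" for z k
    by (subst pd_hyp_chart_transform[OF that _ has_derivative_height_plus_linear])
       (use V in \<open>auto simp: inner_axis\<close>)
  have "((\<lambda>z. a * (z $ j / height z) + \<beta> $ j) has_derivative
      (\<lambda>h. a * ((hyp_gram y *v h) $ j / height y) + 0)) (at y within {y. y $ e \<le> s})"
    by (intro has_derivative_add has_derivative_mult_right has_derivative_div_height has_derivative_const)
  from pd_hyp_chart_transform[OF assms(1) 1 this]
  have 2: "pd ?C i (pd ?C j (V \<circ> param ?C)) y = a * (hyp_gram y $ i $ j / height y)"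
    by (simp add: hyp_gram_axis hyp_gram_sym)
  have 3: "(\<Sum>k\<in>UNIV. y $ k * pd ?C k (V \<circ> param ?C) y) = a * (y \<bullet> y) / height y + \<beta> \<bullet> y"
    by (simp add: 1[OF assms(1)] inner_vec_def distrib_left sum.distrib sum_distrib_left
        sum_divide_distrib mult_ac)
  have "a / height y + a * (y \<bullet> y) / height y = a * ((1 + y \<bullet> y) / height y)"
    by (simp add: field_simps)
  also have "\<dots> = a * height y"
    by (simp flip: height_sq)
  finally have 4: "a / height y + a * (y \<bullet> y) / height y = a * height y" .
  have "a * (hyp_gram y $ i $ j / height y) + hyp_gram y $ i $ j * (a * (y \<bullet> y) / height y + \<beta> \<bullet> y)
      = (a / height y + a * (y \<bullet> y) / height y + \<beta> \<bullet> y) * hyp_gram y $ i $ j"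
    by (simp add: algebra_simps)
  then show ?thesis
    unfolding hess_hyp[OF assms(1)] 2 3 V[OF assms(1)] 4 .
qed

text \<open>For \<open>f\<close> the potential in coordinates, the equation \<open>Hess V = V g\<close> says \<open>\<partial>\<^sub>i \<partial>\<^sub>j f = h g\<^sub>i\<^sub>j\<close> with
  \<open>h = f - (\<Sum>k. y\<^sub>k \<partial>\<^sub>k f)\<close>. In the differential of \<open>h\<close> the first derivatives of \<open>f\<close> cancel and the
  second ones contract to \<open>- h (y \<bullet> v) / (1 + y \<bullet> y)\<close>, which makes \<open>h * height\<close> a constant \<open>a\<close>. Hence the
  gradient of \<open>f\<close> has the same derivative as the gradient of \<open>a * height\<close>, and differs from it by a
  constant vector \<open>\<beta>\<close>. The definition
  of \<open>h\<close> then recovers \<open>f\<close> from its gradient, so no additive constant is left over. Both uses of a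
  vanishing derivative rest on the convexity of the half-space.\<close>

lemma restricted_linear_if_hess:
  fixes V :: "real \<times> (real^'n) \<Rightarrow> real"
  assumes smooth: "smooth_on {y. y $ e \<le> s} (V \<circ> param (hyp_chart e s))"
    and hess: "\<And>y i j. y $ e \<le> s \<Longrightarrow>
      hess (hyp_chart e s) hyp_metric V i j y = V (param (hyp_chart e s) y) * hyp_gram y $ i $ j"
  obtains a \<beta> where "\<And>y. y $ e \<le> s \<Longrightarrow> V (param (hyp_chart e s) y) = a * height y + \<beta> \<bullet> y"
proof -
  let ?C = "hyp_chart e s" and ?S = "{y :: real^'n. y $ e \<le> s}"
  define f where "f = V \<circ> param ?C"
  define p where "p k = pd ?C k f" for k
  define h where "h y = f y - (\<Sum>k\<in>UNIV. y $ k * p k y)" for y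
  have convex: "convex ?S"
    using convex_halfspace_le[of "axis e (1::real)" s] by (simp add: inner_axis')
  have "f differentiable (at y within ?S)"
    and "p k differentiable (at y within ?S)" if "y \<in> ?S" for y k
    using smooth_on_imp_differentiable_within[OF smooth that] frechet_derivative_within_halfspace
    unfolding f_def p_def pd_def[abs_def] chart_dom_hyp_chart by blast+
  then have Df: "(f has_derivative (\<lambda>v. \<Sum>i\<in>UNIV. v $ i * p i y)) (at y within ?S)"
    and Dp': "(p k has_derivative (\<lambda>v. \<Sum>i\<in>UNIV. v $ i * pd ?C i (p k) y)) (at y within ?S)"
    if "y \<in> ?S" for y k
    using pd_has_derivative[of f y ?C] pd_has_derivative[of "p k" y ?C] that by (simp_all add: p_def)
  have pdp: "pd ?C i (p j) y = h y * hyp_gram y $ j $ i" if "y \<in> ?S" for i j y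
    using hess[of y i j] that by (simp add: hess_hyp f_def p_def h_def hyp_gram_sym algebra_simps)
  have Dp: "(p j has_derivative (\<lambda>v. h y * (hyp_gram y *v v) $ j)) (at y within ?S)" if "y \<in> ?S" for y j
    using Dp'[OF that, of j]
    by (simp add: pdp[OF that] matrix_vector_mult_def sum_distrib_left mult_ac)
  have Dh: "(h has_derivative (\<lambda>v. - h y * (y \<bullet> v) / (1 + y \<bullet> y))) (at y within ?S)" if "y \<in> ?S" for y
  proof -
    have h: "h = (\<lambda>z. f z - (\<Sum>k\<in>UNIV. z $ k * p k z))"
      by (rule ext) (rule h_def)
    have "((\<lambda>z. f z - (\<Sum>k\<in>UNIV. z $ k * p k z)) has_derivative (\<lambda>v. (\<Sum>i\<in>UNIV. v $ i * p i y)
        - (\<Sum>k\<in>UNIV. y $ k * (h y * (hyp_gram y *v v) $ k) + v $ k * p k y))) (at y within ?S)"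
      by (intro has_derivative_diff Df has_derivative_sum has_derivative_mult Dp that
          bounded_linear_imp_has_derivative bounded_linear_vec_nth)
    then have "(h has_derivative (\<lambda>v. (\<Sum>i\<in>UNIV. v $ i * p i y)
        - (\<Sum>k\<in>UNIV. y $ k * (h y * (hyp_gram y *v v) $ k) + v $ k * p k y))) (at y within ?S)"
      by (subst (1) h)
    moreover have "(\<Sum>i\<in>UNIV. v $ i * p i y)
        - (\<Sum>k\<in>UNIV. y $ k * (h y * (hyp_gram y *v v) $ k) + v $ k * p k y)
        = - h y * (y \<bullet> (hyp_gram y *v v))" for v
      by (simp add: sum.distrib inner_vec_def sum_distrib_left sum_negf mult_ac)
    moreover have "y \<bullet> (hyp_gram y *v v) = (y \<bullet> v) / (1 + y \<bullet> y)" for v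
      by (simp add: hyp_gram_mult_vec inner_diff_right field_simps)
    ultimately show ?thesis
      by simp
  qed
  have "\<exists>a. \<forall>y\<in>?S. h y * height y = a"
  proof (rule has_derivative_zero_constant[OF convex])
    fix y assume "y \<in> ?S"
    then have "((\<lambda>y. h y * height y) has_derivative
        (\<lambda>v. h y * (y \<bullet> v / height y) + (- h y * (y \<bullet> v) / (1 + y \<bullet> y)) * height y)) (at y within ?S)"
      by (intro has_derivative_mult Dh has_derivative_height)
    moreover have "h y * (y \<bullet> v / height y) + (- h y * (y \<bullet> v) / (1 + y \<bullet> y)) * height y = 0" for v
      by (simp flip: height_sq)
    ultimately show "((\<lambda>y. h y * height y) has_derivative (\<lambda>v. 0)) (at y within ?S)"
      by simp
  qed
  then obtain a where a: "\<And>y. y \<in> ?S \<Longrightarrow> h y = a / height y"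
    by (auto simp: field_simps)
  have "\<exists>c. \<forall>y\<in>?S. p j y - a * (y $ j / height y) = c" for j
  proof (rule has_derivative_zero_constant[OF convex])
    fix y assume y: "y \<in> ?S"
    have "((\<lambda>y. p j y - a * (y $ j / height y)) has_derivative
        (\<lambda>v. h y * (hyp_gram y *v v) $ j - a * ((hyp_gram y *v v) $ j / height y))) (at y within ?S)"
      by (intro has_derivative_diff has_derivative_mult_right has_derivative_div_height Dp y)
    then show "((\<lambda>y. p j y - a * (y $ j / height y)) has_derivative (\<lambda>v. 0)) (at y within ?S)"
      by (simp add: a[OF y])
  qed
  then obtain c where c: "\<And>j y. y \<in> ?S \<Longrightarrow> p j y - a * (y $ j / height y) = c j"
    by metis
  have "f y = a * height y + (\<chi> j. c j) \<bullet> y" if "y \<in> ?S" for y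
  proof -
    have p: "p k y = a * (y $ k / height y) + c k" for k
      using c[OF that, of k] by simp
    have "(\<Sum>k\<in>UNIV. y $ k * p k y) = a * (y \<bullet> y) / height y + (\<chi> j. c j) \<bullet> y"
      unfolding p
      by (simp add: inner_vec_def distrib_left sum.distrib sum_distrib_left sum_divide_distrib mult_ac)
    then have "f y = a * ((1 + y \<bullet> y) / height y) + (\<chi> j. c j) \<bullet> y"
      using a[OF that] by (simp add: h_def field_simps)
    then show ?thesis
      by (simp flip: height_sq)
  qed
  then show ?thesis
    using that by (simp add: f_def)
qed

section \<open>Geometry of the boundary slice\<close>

lemma gprod_hyp:
  fixes y :: "real^'n"
  assumes "y $ e \<le> s"
  shows "gprod (hyp_chart e s) hyp_metric y v w = v \<bullet> (hyp_gram y *v w)"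
  by (simp add: gprod_def gmat_hyp[OF assms])

lemma grad_coord_hyp:
  fixes y :: "real^'n"
  assumes "y $ e = s"
  shows "grad (hyp_chart e s) hyp_metric (hyp_coord (Some e)) y = axis e 1 + s *\<^sub>R y"
proof -
  have le: "y $ e \<le> s"
    using assms by simp
  have "pd (hyp_chart e s) i (hyp_coord (Some e) \<circ> param (hyp_chart e s)) y = axis e 1 $ i" for i
    by (subst pd_hyp_chart_transform[OF le _ bounded_linear_imp_has_derivative[OF bounded_linear_vec_nth]])
       (auto simp: hyp_coord_def param_hyp_chart axis_def)
  then have "(\<chi> i. pd (hyp_chart e s) i (hyp_coord (Some e) \<circ> param (hyp_chart e s)) y) = axis e (1::real)"
    by (simp add: vec_eq_iff)
  then have "grad (hyp_chart e s) hyp_metric (hyp_coord (Some e)) y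
      = matrix_inv (hyp_gram y) *v axis e 1"
    by (simp add: grad_def gmat_hyp[OF le])
  then show ?thesis
    unfolding matrix_vector_mult_basis
    using assms by (simp add: column_def matrix_inv_hyp_gram vec_eq_iff axis_def)
qed

text \<open>The metric dual of the gradient of the coordinate \<open>e\<close> is the covector \<open>axis e 1\<close> defining the
  boundary, so all inner products with the normal direction are read off as components.\<close>

lemma hyp_gram_normal:
  assumes "y $ e = s"
  shows "hyp_gram y *v (axis e 1 + s *\<^sub>R y) = axis e 1"
  using assms
  by (simp add: matrix_vector_right_distrib matrix_vector_mult_scaleR hyp_gram_mult_base)
     (simp add: hyp_gram_mult_vec inner_axis)

lemma one_plus_square_pos: "0 < 1 + s\<^sup>2" for s :: real
  by (simp add: add_pos_nonneg)

lemma gprod_normal: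
  fixes y :: "real^'n"
  assumes "y $ e = s"
  shows "gprod (hyp_chart e s) hyp_metric y v (axis e 1 + s *\<^sub>R y) = v $ e"
  using assms by (simp add: gprod_hyp hyp_gram_normal inner_axis)

lemma gnorm_normal:
  fixes y :: "real^'n"
  assumes "y $ e = s"
  shows "gnorm (hyp_chart e s) hyp_metric y (axis e 1 + s *\<^sub>R y) = sqrt (1 + s\<^sup>2)"
  using assms by (simp add: gnorm_def gprod_normal power2_eq_square)

text \<open>Uniqueness: a vector orthogonal to the boundary differs from a multiple of the gradient by a tangent
  vector that is orthogonal to itself; its length and its side of the boundary fix the multiple.\<close>

lemma outward_normal_hyp:
  fixes y :: "real^'n"
  assumes "y $ e = s"
  shows "outward_normal (hyp_chart e s) hyp_metric y = (1 / sqrt (1 + s\<^sup>2)) *\<^sub>R (axis e 1 + s *\<^sub>R y)"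
proof -
  let ?N = "axis e 1 + s *\<^sub>R y" and ?r = "sqrt (1 + s\<^sup>2)"
  let ?g = "gprod (hyp_chart e s) hyp_metric y"
  have r: "?r > 0" "?r * ?r = 1 + s\<^sup>2"
    using one_plus_square_pos[of s] by simp_all
  have g: "?g v w = v \<bullet> (hyp_gram y *v w)" for v w
    using assms by (simp add: gprod_hyp)
  have sym: "?g v w = ?g w v" for v w
    by (simp add: g hyp_gram_mult_vec inner_diff_right inner_commute)
  have N: "?g v ?N = v $ e" for v
    using assms by (rule gprod_normal)
  have Ne: "?N $ e = 1 + s\<^sup>2"
    using assms by (simp add: power2_eq_square)
  show ?thesis
    unfolding outward_normal_def covec_hyp_chart gnorm_def
  proof (rule the_equality)
    have "?g ((1 / ?r) *\<^sub>R ?N) ((1 / ?r) *\<^sub>R ?N) = (1 / ?r) * ((1 / ?r) * ?g ?N ?N)"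
      by (simp only: g matrix_vector_mult_scaleR inner_scaleR_left inner_scaleR_right)
    also have "\<dots> = 1"
      unfolding N Ne using r by (simp add: field_simps)
    finally have 1: "?g ((1 / ?r) *\<^sub>R ?N) ((1 / ?r) *\<^sub>R ?N) = 1" .
    have 2: "?g ((1 / ?r) *\<^sub>R ?N) v = (1 / ?r) * v $ e" for v
      unfolding sym[of _ v] by (simp only: g matrix_vector_mult_scaleR inner_scaleR_right) (simp only: g[symmetric] N)
    have 3: "0 < ((1 / ?r) *\<^sub>R ?N) $ e"
      using r one_plus_square_pos[of s] by (simp only: vector_scaleR_component Ne) simp
    show "sqrt (?g ((1 / ?r) *\<^sub>R ?N) ((1 / ?r) *\<^sub>R ?N)) = 1 \<and>
        (\<forall>v. v $ e = 0 \<longrightarrow> ?g ((1 / ?r) *\<^sub>R ?N) v = 0) \<and> 0 < ((1 / ?r) *\<^sub>R ?N) $ e"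
      using 1 2 3 by (simp only: real_sqrt_one) simp
  next
    fix \<eta> assume \<eta>: "sqrt (?g \<eta> \<eta>) = 1 \<and> (\<forall>v. v $ e = 0 \<longrightarrow> ?g \<eta> v = 0) \<and> 0 < \<eta> $ e"
    \<comment> \<open>The coefficient \<open>t\<close> makes the component of \<open>d\<close> along \<open>e\<close> vanish, so \<open>d\<close> is tangent to the boundary.\<close>
    define t where "t = \<eta> $ e / (1 + s\<^sup>2)"
    define d where "d = \<eta> - t *\<^sub>R ?N"
    have "d $ e = \<eta> $ e - t * ?N $ e"
      by (simp add: d_def)
    then have d: "d $ e = 0"
      unfolding Ne t_def using one_plus_square_pos[of s] by simp
    have "?g d d = ?g d \<eta> - t * ?g d ?N"
      by (simp only: g d_def[of] matrix_vector_mult_diff_distrib matrix_vector_mult_scaleR inner_diff_right inner_scaleR_right)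
    also have "\<dots> = 0"
      using \<eta> d by (simp add: N sym[of d \<eta>])
    finally have "d = 0"
      using hyp_gram_pos[of d y] by (auto simp: g)
    then have eq: "\<eta> = t *\<^sub>R ?N"
      by (simp add: d_def)
    have "?g \<eta> \<eta> = t * (t * ?g ?N ?N)"
      unfolding eq by (simp only: g matrix_vector_mult_scaleR inner_scaleR_left inner_scaleR_right)
    then have "(t * ?r) * (t * ?r) = 1"
      unfolding N Ne using \<eta> r by (simp add: mult_ac)
    moreover have "t > 0"
      using \<eta> one_plus_square_pos[of s] by (simp add: t_def)
    ultimately have "t * ?r = 1"
      using r by (metis abs_of_pos mult_pos_pos real_sqrt_abs2 real_sqrt_one)
    then have "t = 1 / ?r"
      using r by (simp add: field_simps)
    then show "\<eta> = (1 / ?r) *\<^sub>R ?N"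
      using eq by simp
  qed
qed

text \<open>Along the boundary the normal field is affine in the coordinates, with linear part
  \<open>hyp_lambda s\<close> times the identity, and the Christoffel correction is proportional to
  \<open>g(X, \<eta>) = 0\<close>.\<close>

lemma second_ff_hyp:
  fixes y :: "real^'n"
  assumes "y $ e = s" "X $ e = 0"
  shows "second_ff (hyp_chart e s) hyp_metric y X Y
    = hyp_lambda s * gprod (hyp_chart e s) hyp_metric y X Y"
proof -
  let ?C = "hyp_chart e s" and ?b = "hyp_metric :: 'n minkowski \<Rightarrow> _"
  let ?\<eta> = "outward_normal ?C ?b"
  have \<eta>: "?\<eta> (y + t *\<^sub>R X) = (1 / sqrt (1 + s\<^sup>2)) *\<^sub>R (axis e 1 + s *\<^sub>R (y + t *\<^sub>R X))" for t
    using assms by (intro outward_normal_hyp) simp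
  have "((\<lambda>t. (1 / sqrt (1 + s\<^sup>2)) *\<^sub>R (axis e 1 + s *\<^sub>R (y + t *\<^sub>R X)))
      has_vector_derivative hyp_lambda s *\<^sub>R X) (at 0)"
    by (auto intro!: derivative_eq_intros simp: hyp_lambda_def)
  then have deriv: "vector_derivative (\<lambda>t. ?\<eta> (y + t *\<^sub>R X)) (at 0) = hyp_lambda s *\<^sub>R X"
    unfolding \<eta> by (rule vector_derivative_at)
  have "(\<Sum>i\<in>UNIV. \<Sum>j\<in>UNIV. christoffel ?C ?b k i j y * X $ i * ?\<eta> y $ j)
      = - y $ k * (X \<bullet> (hyp_gram y *v ?\<eta> y))" for k
    using assms
    by (simp add: christoffel_hyp matrix_vector_mult_def inner_vec_def sum_distrib_left sum_negf mult_ac)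
  moreover have "X \<bullet> (hyp_gram y *v ?\<eta> y) = 0"
    unfolding outward_normal_hyp[OF assms(1)] matrix_vector_mult_scaleR hyp_gram_normal[OF assms(1)]
    using assms(2) by (simp add: inner_axis)
  ultimately have "cov_deriv ?C ?b y X ?\<eta> = hyp_lambda s *\<^sub>R X"
    by (simp add: cov_deriv_def deriv vec_eq_iff)
  then show ?thesis
    by (simp add: second_ff_def gprod_def)
qed

text \<open>The Robin condition with constant \<open>hyp_lambda s\<close> fails for a linear function exactly by its
  coefficient along the coordinate \<open>e\<close>. This excludes that coordinate from the potentials and admits
  all the others.\<close>

lemma normal_deriv_hyp:
  fixes y :: "real^'n"
  assumes "y $ e = s"
    and V: "\<And>z. z $ e \<le> s \<Longrightarrow> V (param (hyp_chart e s) z) = a * height z + \<beta> \<bullet> z"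
  shows "normal_deriv (hyp_chart e s) hyp_metric V y
    = hyp_lambda s * V (param (hyp_chart e s) y) + \<beta> $ e / sqrt (1 + s\<^sup>2)"
proof -
  let ?N = "axis e 1 + s *\<^sub>R y" and ?r = "sqrt (1 + s\<^sup>2)"
  have le: "y $ e \<le> s"
    using assms(1) by simp
  have "((V \<circ> param (hyp_chart e s)) has_derivative (\<lambda>h. a * (y \<bullet> h / height y) + \<beta> \<bullet> h))
      (at y within {y. y $ e \<le> s})"
    by (rule has_derivative_transform[OF _ _ has_derivative_height_plus_linear]) (use le V in simp_all)
  then have "normal_deriv (hyp_chart e s) hyp_metric V y
      = a * (y \<bullet> ((1 / ?r) *\<^sub>R ?N) / height y) + \<beta> \<bullet> ((1 / ?r) *\<^sub>R ?N)"
    by (simp only: normal_deriv_def chart_dom_hyp_chart frechet_derivative_within_halfspace[OF le]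
        outward_normal_hyp[OF assms(1)])
  also have "\<dots> = (a * (y \<bullet> ?N / height y) + \<beta> \<bullet> ?N) / ?r"
    by (simp add: add_divide_distrib)
  also have "y \<bullet> ?N = s * (height y * height y)"
    using assms(1) by (simp add: height_sq inner_add_right inner_axis algebra_simps)
  also have "\<beta> \<bullet> ?N = \<beta> $ e + s * (\<beta> \<bullet> y)"
    by (simp add: inner_add_right inner_axis)
  finally show ?thesis
    by (simp add: V[OF le] hyp_lambda_def add_divide_distrib algebra_simps)
qed

lemma hyp_half_eq_image: "hyp_half e s = param (hyp_chart e s) ` {y. y $ e \<le> s}"
proof -
  have "p \<in> hyperboloid \<longleftrightarrow> p = (height (snd p), snd p)" for p :: "real \<times> (real^'n)"
  proof (cases p)
    case (Pair t y)
    have "t = height y" if "- (t * t) + y \<bullet> y = -1" "t > 0"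
      unfolding height_def using that by (intro real_sqrt_unique[symmetric]) (simp_all add: power2_eq_square)
    then show ?thesis
      using Pair height_sq[of y] by (auto simp: hyperboloid_def mink_def)
  qed
  then show ?thesis
    by (auto simp: hyp_half_def hyp_coord_def param_hyp_chart image_iff)
qed

section \<open>Static potentials on the half-space of the hyperboloid\<close>

lemma smooth_height_plus_linear: "smooth_on S (\<lambda>y::real^'n. a * height y + \<beta> \<bullet> y)"
  by (rule smooth_onI[where F = "\<lambda>y. a * height y + \<beta> \<bullet> y"])
     (intro Ck_on_add Ck_on_mult Ck_on_const Ck_on_height Ck_on_bounded_linear bounded_linear_inner_right,
       simp_all)

lemma smooth_on_cong:
  assumes "smooth_on S f" "\<And>x. x \<in> S \<Longrightarrow> f x = g x"
  shows "smooth_on S g"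
  using assms unfolding smooth_on_def by (metis IntD2)

lemma riemannian_manifold_hyp_half:
  fixes e :: "'n::finite"
  shows "riemannian_manifold_with_boundary (hyp_half e s) {hyp_chart e s} hyp_metric"
proof -
  let ?S = "{y :: real^'n. y $ e \<le> s}"
  have param: "param (hyp_chart e s) = (\<lambda>y::real^'n. (height y, y))"
    by (simp add: fun_eq_iff param_hyp_chart)
  have smooth_param: "smooth_on ?S (param (hyp_chart e s))"
  proof (rule smooth_onI[where F = "\<lambda>y. (height y, 0) + (0, y)"])
    fix k
    \<comment> \<open>The splitting exhibits the parametrization as a product plus a linear map.\<close>
    have "Ck_on k UNIV (\<lambda>y::real^'n. height y *\<^sub>R (1::real, 0::real^'n) + (0, y))"
      by (intro Ck_on_add Ck_on_scaleR Ck_on_height Ck_on_const Ck_on_bounded_linear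
          bounded_linear_Pair bounded_linear_zero bounded_linear_ident) simp_all
    then show "Ck_on k UNIV (\<lambda>y::real^'n. (height y, 0) + (0, y))"
      by simp
  qed (simp add: param)
  have smooth_gmat: "smooth_on ?S (gmat (hyp_chart e s) hyp_metric)"
    by (rule smooth_onI[OF Ck_on_hyp_gram]) (simp add: gmat_hyp)
  have "homeomorphism ?S (hyp_half e s) (param (hyp_chart e s)) snd"
    unfolding hyp_half_eq_image
  proof (rule homeomorphismI)
    show "continuous_on ?S (param (hyp_chart e s))"
      unfolding param using Ck_on_height[of 0]
      by (intro continuous_on_Pair) (auto intro: continuous_on_subset)
    show "continuous_on (param (hyp_chart e s) ` ?S) snd"
      by (intro continuous_intros)
  qed (auto simp: param)
  then have homeo: "\<exists>\<psi>. homeomorphism ?S (hyp_half e s) (param (hyp_chart e s)) \<psi>"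
    by blast
  have bilinear: "bilinear (hyp_metric p)" "hyp_metric p u v = hyp_metric p v u"
    for p u v :: "'n minkowski"
    by (auto simp: bilinear_def hyp_metric_def mink_def inner_add_left inner_add_right inner_commute
        algebra_simps intro!: linearI)
  have base: "base (hyp_chart e s) = UNIV"
    by (simp add: hyp_chart_def)
  show ?thesis
    unfolding riemannian_manifold_with_boundary_def
    using smooth_param smooth_gmat homeo bilinear
    by (simp add: gmat_hyp base hyp_gram_pos flip: hyp_half_eq_image)
qed

lemma manifold_boundary_hyp_half: "manifold_boundary {hyp_chart e s} = hyp_slice e s"
proof -
  have "hyp_slice e s = {p \<in> hyp_half e s. snd p $ e = s}"
    unfolding hyp_slice_def hyp_half_def hyp_coord_def option.case by (rule Collect_cong) auto
  also have "\<dots> = param (hyp_chart e s) ` {y. y $ e = s}"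
    unfolding hyp_half_eq_image by (auto simp: param_hyp_chart)
  finally show ?thesis
    by (simp add: manifold_boundary_def)
qed

lemma static_potential_hyp_iff:
  fixes e :: "'n::finite" and s :: real
  assumes "2 \<le> CARD('n)"
  shows "static_potential (hyp_half e s) {hyp_chart e s} hyp_metric
      (- (real CARD('n) * (real CARD('n) - 1) / 2)) ((real CARD('n) - 1) * hyp_lambda s) V \<longleftrightarrow>
    (\<exists>p\<in>hyp_half e s. V p \<noteq> 0) \<and>
    (\<exists>a \<beta>. \<beta> $ e = 0 \<and> (\<forall>p\<in>hyp_half e s. V p = a * fst p + \<beta> \<bullet> snd p))"
    (is "?static \<longleftrightarrow> ?nz \<and> ?lin")
proof -
  let ?C = "hyp_chart e s" and ?b = "hyp_metric :: 'n minkowski \<Rightarrow> _"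
  let ?smooth = "smooth_on {y. y $ e \<le> s} (V \<circ> param ?C)"
  let ?hess = "\<forall>y. y $ e \<le> s \<longrightarrow>
    (\<forall>i j. hess ?C ?b V i j y = V (param ?C y) * hyp_gram y $ i $ j)"
  let ?robin = "\<forall>y. y $ e = s \<longrightarrow> normal_deriv ?C ?b V y = hyp_lambda s * V (param ?C y)"
  have n: "real CARD('n) - 1 \<noteq> 0"
    using assms by simp
  have L: "2 / (real CARD('n) - 1) * - (real CARD('n) * (real CARD('n) - 1) / 2) = - real CARD('n)"
    using n by (simp add: field_simps)
  have l: "1 / (real CARD('n) - 1) * ((real CARD('n) - 1) * hyp_lambda s) = hyp_lambda s"
    using n by simp
  have static: "?static \<longleftrightarrow> ?smooth \<and> ?nz \<and> ?hess \<and> ?robin"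
    unfolding static_potential_def Let_def L l
    using static_equations_hyp_iff[of _ e s V] by (simp add: second_ff_hyp)
  have lin: "?lin \<longleftrightarrow> (\<exists>a \<beta>. \<beta> $ e = 0 \<and> (\<forall>y. y $ e \<le> s \<longrightarrow> V (param ?C y) = a * height y + \<beta> \<bullet> y))"
    by (simp add: hyp_half_eq_image param_hyp_chart)
  show ?thesis
  proof (intro iffI conjI)
    assume ?static
    then have smooth: ?smooth and nz: ?nz and hess: ?hess and robin: ?robin
      unfolding static by blast+
    show ?nz by (rule nz)
    obtain a \<beta> where V: "\<And>y. y $ e \<le> s \<Longrightarrow> V (param ?C y) = a * height y + \<beta> \<bullet> y"
      using restricted_linear_if_hess[OF smooth] hess by blast
    \<comment> \<open>The Robin condition at a single boundary point already forces the coefficient of \<open>e\<close> to vanish.\<close>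
    define y :: "real^'n" where "y = axis e s"
    have y: "y $ e = s"
      by (simp add: y_def)
    have "\<beta> $ e / sqrt (1 + s\<^sup>2) = 0"
      using normal_deriv_hyp[where V = V, OF y V] robin y by simp
    then have "\<beta> $ e = 0"
      using one_plus_square_pos[of s] by simp
    then show ?lin
      unfolding lin using V by blast
  next
    assume "?nz \<and> ?lin"
    then obtain a \<beta> where nz: ?nz and \<beta>: "\<beta> $ e = 0"
      and V: "\<And>y. y $ e \<le> s \<Longrightarrow> V (param ?C y) = a * height y + \<beta> \<bullet> y"
      unfolding lin by blast
    have ?smooth
      by (rule smooth_on_cong[OF smooth_height_plus_linear[of _ a \<beta>]]) (simp add: V)
    moreover have ?hess
      using hess_restricted_linear[where V = V, OF _ V] by blast
    moreover have ?robin
      using normal_deriv_hyp[where V = V, OF _ V] \<beta> by simp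
    ultimately show ?static
      unfolding static using nz by blast
  qed
qed

lemma sum_hyp_coord:
  fixes e :: "'n::finite" and p :: "'n minkowski"
  shows "(\<Sum>i\<in>UNIV - {Some e}. c i * hyp_coord i p)
    = c None * fst p + (\<chi> j. if j = e then 0 else c (Some j)) \<bullet> snd p"
proof -
  have "UNIV - {Some e} = insert None (Some ` (UNIV - {e}))"
    by (auto simp: UNIV_option_conv)
  then have "(\<Sum>i\<in>UNIV - {Some e}. c i * hyp_coord i p)
      = c None * fst p + (\<Sum>j\<in>UNIV - {e}. c (Some j) * snd p $ j)"
    by (simp add: sum.reindex hyp_coord_def)
  also have "(\<Sum>j\<in>UNIV - {e}. c (Some j) * snd p $ j)
      = (\<Sum>j\<in>UNIV. (if j = e then 0 else c (Some j)) * snd p $ j)"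
    by (rule sum.mono_neutral_cong_left) auto
  finally show ?thesis
    by (simp add: inner_vec_def)
qed

text \<open>Linear functions on Minkowski space without component along \<open>e\<close> are parametrized by a scalar and a
  vector; this matches them with the coefficient families of the span.\<close>

lemma hyp_coord_span_iff:
  fixes e :: "'n::finite" and M :: "'n minkowski set"
  shows "(\<exists>c. \<forall>p\<in>M. V p = (\<Sum>i\<in>UNIV - {Some e}. c i * hyp_coord i p))
    \<longleftrightarrow> (\<exists>a \<beta>. \<beta> $ e = 0 \<and> (\<forall>p\<in>M. V p = a * fst p + \<beta> \<bullet> snd p))"
proof (intro iffI; elim exE conjE)
  fix c assume "\<forall>p\<in>M. V p = (\<Sum>i\<in>UNIV - {Some e}. c i * hyp_coord i p)"
  then show "\<exists>a \<beta>. \<beta> $ e = 0 \<and> (\<forall>p\<in>M. V p = a * fst p + \<beta> \<bullet> snd p)"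
    by (intro exI[of _ "c None"] exI[of _ "\<chi> j. if j = e then 0 else c (Some j)"])
       (simp add: sum_hyp_coord)
next
  fix a and \<beta> :: "real^'n"
  assume \<beta>: "\<beta> $ e = 0" and V: "\<forall>p\<in>M. V p = a * fst p + \<beta> \<bullet> snd p"
  have "(\<chi> j. if j = e then 0 else \<beta> $ j) = \<beta>"
    using \<beta> by (simp add: vec_eq_iff)
  with V show "\<exists>c. \<forall>p\<in>M. V p = (\<Sum>i\<in>UNIV - {Some e}. c i * hyp_coord i p)"
    by (intro exI[of _ "case_option a (($) \<beta>)"]) (simp add: sum_hyp_coord cong: if_cong)
qed

lemma normal_deriv_hyp_coord:
  fixes y :: "real^'n"
  assumes "y $ e = s" "i \<noteq> Some e"
  shows "normal_deriv (hyp_chart e s) hyp_metric (hyp_coord i) y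
    = hyp_lambda s * hyp_coord i (param (hyp_chart e s) y)"
proof (cases i)
  case None
  then show ?thesis
    using normal_deriv_hyp[where V = "hyp_coord i" and a = 1 and \<beta> = 0, OF assms(1)]
    by (simp add: hyp_coord_def param_hyp_chart)
next
  case (Some j)
  then have "axis j (1::real) $ e = 0"
    using assms(2) by (simp add: axis_def)
  then show ?thesis
    using normal_deriv_hyp[where V = "hyp_coord i" and a = 0 and \<beta> = "axis j 1", OF assms(1)] Some
    by (simp add: hyp_coord_def param_hyp_chart inner_axis')
qed

theorem proposition1p6:
  fixes e :: "'n::finite" and s :: real
  assumes "2 \<le> CARD('n)"
  shows
    "let C = hyp_chart e s;
         b = hyp_metric;
         M = hyp_half e s;
         cL = - (real CARD('n) * (real CARD('n) - 1) / 2);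
         cl = (real CARD('n) - 1) * hyp_lambda s
     in
       (\<forall>x\<in>chart_bdry C.
          let G = grad C b (hyp_coord (Some e)) x in
          outward_normal C b x = (1 / gnorm C b x G) *\<^sub>R G \<and>
          gnorm C b x G = sqrt (1 + s\<^sup>2) \<and>
          (\<forall>X Y. covec C \<bullet> X = 0 \<longrightarrow> covec C \<bullet> Y = 0 \<longrightarrow>
             second_ff C b x X Y = hyp_lambda s * gprod C b x X Y) \<and>
          hyp_lambda s = hyp_coord (Some e) (param C x) / gnorm C b x G \<and>
          (\<forall>i. i \<noteq> Some e \<longrightarrow>
             normal_deriv C b (hyp_coord i) x = hyp_lambda s * hyp_coord i (param C x))) \<and>
       static_manifold_with_boundary M {C} b (hyp_slice e s) cL cl \<and>
       {restrict V M | V. static_potential M {C} b cL cl V} \<union> {restrict (\<lambda>p. 0) M} =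
         {restrict (\<lambda>p. \<Sum>i\<in>UNIV - {Some e}. c i * hyp_coord i p) M | c. True}"
proof -
  let ?C = "hyp_chart e s" and ?b = "hyp_metric :: 'n minkowski \<Rightarrow> _" and ?M = "hyp_half e s"
  let ?cL = "- (real CARD('n) * (real CARD('n) - 1) / 2)"
  let ?cl = "(real CARD('n) - 1) * hyp_lambda s"
  let ?sum = "\<lambda>c p. \<Sum>i\<in>UNIV - {Some e}. c i * hyp_coord i p"
  have bdry: "let G = grad ?C ?b (hyp_coord (Some e)) x in
          outward_normal ?C ?b x = (1 / gnorm ?C ?b x G) *\<^sub>R G \<and>
          gnorm ?C ?b x G = sqrt (1 + s\<^sup>2) \<and>
          (\<forall>X Y. covec ?C \<bullet> X = 0 \<longrightarrow> covec ?C \<bullet> Y = 0 \<longrightarrow>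
             second_ff ?C ?b x X Y = hyp_lambda s * gprod ?C ?b x X Y) \<and>
          hyp_lambda s = hyp_coord (Some e) (param ?C x) / gnorm ?C ?b x G \<and>
          (\<forall>i. i \<noteq> Some e \<longrightarrow>
             normal_deriv ?C ?b (hyp_coord i) x = hyp_lambda s * hyp_coord i (param ?C x))"
    if x: "x \<in> chart_bdry ?C" for x
  proof -
    have x: "x $ e = s"
      using x by simp
    then have "hyp_coord (Some e) (param ?C x) = s"
      by (simp add: hyp_coord_def param_hyp_chart)
    then show ?thesis
      unfolding Let_def grad_coord_hyp[OF x] gnorm_normal[OF x] outward_normal_hyp[OF x] covec_hyp_chart
      using second_ff_hyp[OF x] normal_deriv_hyp_coord[OF x] by (auto simp: hyp_lambda_def)
  qed
  have potential: "static_potential ?M {?C} ?b ?cL ?cl V \<longleftrightarrow>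
      (\<exists>p\<in>?M. V p \<noteq> 0) \<and> (\<exists>c. \<forall>p\<in>?M. V p = ?sum c p)" for V
    unfolding static_potential_hyp_iff[OF assms] hyp_coord_span_iff ..
  have "param ?C (axis e s) \<in> ?M"
    by (simp add: hyp_half_eq_image)
  \<comment> \<open>The time coordinate is a potential, and it vanishes nowhere.\<close>
  then have "static_potential ?M {?C} ?b ?cL ?cl fst"
    unfolding static_potential_hyp_iff[OF assms]
    by (intro conjI bexI[of _ "param ?C (axis e s)"] exI[of _ 1] exI[of _ 0])
       (simp_all add: param_hyp_chart)
  then have static: "static_manifold_with_boundary ?M {?C} ?b (hyp_slice e s) ?cL ?cl"
    unfolding static_manifold_with_boundary_def
    using riemannian_manifold_hyp_half manifold_boundary_hyp_half by blast
  have "{restrict V ?M | V. static_potential ?M {?C} ?b ?cL ?cl V} \<union> {restrict (\<lambda>p. 0) ?M}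
      = {restrict (?sum c) ?M | c. True}" (is "?pots \<union> {?zero} = ?span")
  proof (intro equalityI subsetI)
    fix f assume "f \<in> ?pots \<union> {?zero}"
    then consider V where "f = restrict V ?M" "static_potential ?M {?C} ?b ?cL ?cl V" | "f = ?zero"
      by blast
    then have "\<exists>c. f = restrict (?sum c) ?M"
    proof cases
      case 1
      then obtain c where "\<forall>p\<in>?M. V p = ?sum c p"
        unfolding potential by (elim conjE exE)
      then show ?thesis
        unfolding 1 by (intro exI[of _ c] restrict_ext) (rule bspec)
    next
      case 2
      then show ?thesis
        by (intro exI[of _ "\<lambda>_. 0"]) simp
    qed
    then show "f \<in> ?span"
      by simp
  next
    fix f assume "f \<in> ?span"
    then obtain c where f: "f = restrict (?sum c) ?M"
      by blast
    show "f \<in> ?pots \<union> {?zero}"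
    proof (cases "\<exists>p\<in>?M. ?sum c p \<noteq> 0")
      case True
      then have "static_potential ?M {?C} ?b ?cL ?cl (?sum c)"
        unfolding potential by blast
      then show ?thesis
        unfolding f by blast
    next
      case False
      then have "f = ?zero"
        unfolding f by (intro restrict_ext) blast
      then show ?thesis
        by blast
    qed
  qed
  from conjI[OF static this] show ?thesis
    unfolding Let_def by (intro conjI[of "\<forall>x\<in>_. _ x"] ballI) (rule bdry[unfolded Let_def])
qed

end
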